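(* Let $\vec d$ be the directed distance and $d$ the bid–ask distance on $\mathcal{P}_1$ (defined in the context), and let $\mathcal{W}_1$ be the 1-Wasserstein distance on $\mathcal{P}_1$. Then: (i) For $\mu,\nu\in\mathcal{P}_1$, $\vec d(\mu,\nu)=0$ if and only if $\mu\preceq_{\rm cx}\nu$. (ii) $\vec d$ is an asymmetric distance on $\mathcal{P}_1$: it is nonnegative, satisfies the triangle inequality, and separates points in the sense that $\vec d(\mu,\nu)=\vec d(\nu,\mu)=0$ implies $\mu=\nu$. Consequently, $d$ is a metric on $\mathcal{P}_1$. (iii) If $\mu,\nu\in\mathcal{P}_1$ have identical barycenters, then $$\vec d(\mu,\nu)=2\sup_{K\ge0}\left(\mathbb{E}_\mu[(X-K)^+]-\mathbb{E}_\nu[(X-K)^+]\right).$$ (iv) $d(\mu,\nu)\le\mathcal{W}_1(\mu,\nu)$ for all $\mu,\nu\in\mathcal{P}_1$. Moreover, there exist sequences $(\mu_n),(\nu_n)$ in $\mathcal{P}_1$ such that $\lim_{n\to\infty}d(\mu_n,\nu_n)=0$ while $\mathcal{W}_1(\mu_n,\nu_n)=1$ for all $n\in\mathbb{N}$. (v) The metrics $d$ and $\mathcal{W}_1$ induce the same topology on $\mathcal{P}_1$.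
   Context: $\mathbb{R}_+=[0,\infty)$; $\mathcal{P}_1$ is the set of probability measures on $\mathbb{R}_+$ with finite first moment. $\mathbb{E}_\mu[f(X)]=\mu(f)=\int f\,d\mu$ and $(\mu-\nu)(\psi)=\mu(\psi)-\nu(\psi)$. $\mu\preceq_{\rm cx}\nu$ (convex order) means $\mu(\psi)\le\nu(\psi)$ for all continuous convex $\psi:\mathbb{R}_+\to\mathbb{R}$ of linear growth. For $\mu,\nu\in\mathcal{P}_1$, $$\vec d(\mu,\nu)=\sup\{(\mu-\nu)(\psi):\psi:\mathbb{R}_+\to\mathbb{R}\text{ convex, }\mathrm{Lip}(\psi)\le1\},\qquad d(\mu,\nu)=\frac{\vec d(\mu,\nu)+\vec d(\nu,\mu)}{2},$$ where $\mathrm{Lip}(\psi)$ is the Lipschitz constant of $\psi$. *)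

theory Defs
  imports "HOL-Probability.Probability"
begin

definition P1 :: "real measure set" where
  "P1 = {\<mu>. prob_space \<mu> \<and> sets \<mu> = sets (restrict_space borel {0..}) \<and> integrable \<mu> (\<lambda>x. x)}"

definition linear_growth :: "(real \<Rightarrow> real) \<Rightarrow> bool" where
  "linear_growth \<psi> \<longleftrightarrow> (\<exists>C. \<forall>x\<ge>0. \<bar>\<psi> x\<bar> \<le> C * (1 + x))"

text \<open>Functions on the half-line are represented by functions on the reals, constrained only
  on \<open>{0..}\<close>. Measures in \<^const>\<open>P1\<close> have \<open>{0..}\<close> as their space, so integrals against
  them do not depend on the values elsewhere.\<close>

definition convex_order :: "real measure \<Rightarrow> real measure \<Rightarrow> bool" (infix "\<preceq>\<^sub>c\<^sub>x" 50) where
  "\<mu> \<preceq>\<^sub>c\<^sub>x \<nu> \<longleftrightarrow> (\<forall>\<psi>. continuous_on {0..} \<psi> \<and> convex_on {0..} \<psi> \<and> linear_growth \<psi>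
      \<longrightarrow> (\<integral>x. \<psi> x \<partial>\<mu>) \<le> (\<integral>x. \<psi> x \<partial>\<nu>))"

definition convex_lip1 :: "(real \<Rightarrow> real) set" where
  "convex_lip1 = {\<psi>. convex_on {0..} \<psi> \<and> 1-lipschitz_on {0..} \<psi>}"

text \<open>The distances below are only meaningful on \<^const>\<open>P1\<close>. They are set to 0 elsewhere because
  the library's \<^locale>\<open>Metric_space\<close> asks for nonnegativity and symmetry on the whole type, not
  only on the carrier.\<close>

definition directed_dist :: "real measure \<Rightarrow> real measure \<Rightarrow> real" where
  "directed_dist \<mu> \<nu> =
     (if \<mu> \<in> P1 \<and> \<nu> \<in> P1
      then (SUP \<psi>\<in>convex_lip1. (\<integral>x. \<psi> x \<partial>\<mu>) - (\<integral>x. \<psi> x \<partial>\<nu>)) else 0)"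

definition bid_ask_dist :: "real measure \<Rightarrow> real measure \<Rightarrow> real" where
  "bid_ask_dist \<mu> \<nu> = (directed_dist \<mu> \<nu> + directed_dist \<nu> \<mu>) / 2"

definition couplings :: "real measure \<Rightarrow> real measure \<Rightarrow> (real \<times> real) measure set" where
  "couplings \<mu> \<nu> =
     {\<pi>. sets \<pi> = sets (\<mu> \<Otimes>\<^sub>M \<nu>) \<and> distr \<pi> \<mu> fst = \<mu> \<and> distr \<pi> \<nu> snd = \<nu>}"

definition wasserstein1 :: "real measure \<Rightarrow> real measure \<Rightarrow> real" where
  "wasserstein1 \<mu> \<nu> =
     (if \<mu> \<in> P1 \<and> \<nu> \<in> P1
      then (INF \<pi>\<in>couplings \<mu> \<nu>. \<integral>z. \<bar>fst z - snd z\<bar> \<partial>\<pi>) else 0)"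

text \<open>The suprema and infima above and in the call-price formula are genuine real-valued ones: the
  sets are nonempty and bounded, and the functions involved are integrable.\<close>

lemma P1D:
  assumes "\<mu> \<in> P1"
  shows "prob_space \<mu>" "sets \<mu> = sets (restrict_space borel {0..})" "space \<mu> = {0..}"
    "integrable \<mu> (\<lambda>x. x)"
  using assms sets_eq_imp_space_eq[of \<mu> "restrict_space borel {0..}"]
  by (auto simp: P1_def space_restrict_space)

lemma measurable_P1_continuous:
  assumes "\<mu> \<in> P1" "continuous_on {0..} (f :: real \<Rightarrow> real)"
  shows "f \<in> borel_measurable \<mu>"
  using borel_measurable_continuous_on_restrict[OF assms(2)] P1D(2)[OF assms(1)]
  by (simp cong: measurable_cong_sets)

lemma integrable_P1_linear_growth:
  assumes "\<mu> \<in> P1" "continuous_on {0..} f" "linear_growth f"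
  shows "integrable \<mu> f"
proof -
  interpret prob_space \<mu> using P1D(1)[OF assms(1)] .
  obtain C where C: "\<And>x. x \<ge> 0 \<Longrightarrow> \<bar>f x\<bar> \<le> C * (1 + x)"
    using assms(3) by (auto simp: linear_growth_def)
  show ?thesis
  proof (rule Bochner_Integration.integrable_bound)
    show "integrable \<mu> (\<lambda>x. C * (1 + x))" using P1D(4)[OF assms(1)] by simp
    show "AE x in \<mu>. norm (f x) \<le> norm (C * (1 + x))"
      using C P1D(3)[OF assms(1)] by (intro AE_I2) fastforce
  qed (rule measurable_P1_continuous[OF assms(1,2)])
qed

lemma convex_lip1_linear_growth:
  assumes "\<psi> \<in> convex_lip1"
  shows "continuous_on {0..} \<psi>" "linear_growth \<psi>"
    and "x \<ge> 0 \<Longrightarrow> \<bar>\<psi> x - \<psi> 0\<bar> \<le> x"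
proof -
  have L: "1-lipschitz_on {0..} \<psi>" using assms by (simp add: convex_lip1_def)
  show "continuous_on {0..} \<psi>" using L lipschitz_on_continuous_on by blast
  have b: "\<bar>\<psi> x - \<psi> 0\<bar> \<le> x" if "x \<ge> 0" for x
    using lipschitz_onD[OF L, of x 0] that by (simp add: dist_real_def)
  then show "x \<ge> 0 \<Longrightarrow> \<bar>\<psi> x - \<psi> 0\<bar> \<le> x" .
  have "\<bar>\<psi> x\<bar> \<le> (\<bar>\<psi> 0\<bar> + 1) * (1 + x)" if "x \<ge> 0" for x
  proof -
    have "\<bar>\<psi> x\<bar> \<le> \<bar>\<psi> 0\<bar> + x" using b[OF that] by linarith
    also have "\<dots> \<le> (\<bar>\<psi> 0\<bar> + 1) * (1 + x)" using that by (simp add: algebra_simps)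
    finally show ?thesis .
  qed
  then show "linear_growth \<psi>" unfolding linear_growth_def by blast
qed

lemma convex_lip1_nonempty: "convex_lip1 \<noteq> {}"
proof -
  have "(\<lambda>x. 0) \<in> convex_lip1"
    by (auto simp: convex_lip1_def convex_on_def lipschitz_on_def)
  then show ?thesis by blast
qed

lemma directed_dist_bdd_above:
  assumes "\<mu> \<in> P1" "\<nu> \<in> P1"
  shows "bdd_above ((\<lambda>\<psi>. (\<integral>x. \<psi> x \<partial>\<mu>) - (\<integral>x. \<psi> x \<partial>\<nu>)) ` convex_lip1)"
proof (rule bdd_aboveI2)
  fix \<psi> assume psi: "\<psi> \<in> convex_lip1"
  note g = convex_lip1_linear_growth[OF psi]
  have *: "\<bar>(\<integral>x. \<psi> x \<partial>\<rho>) - \<psi> 0\<bar> \<le> (\<integral>x. x \<partial>\<rho>)" if "\<rho> \<in> P1" for \<rho>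
  proof -
    interpret prob_space \<rho> using P1D(1)[OF that] .
    have i: "integrable \<rho> \<psi>" using integrable_P1_linear_growth[OF that g(1,2)] .
    have "(\<integral>x. \<psi> x \<partial>\<rho>) - \<psi> 0 = (\<integral>x. \<psi> x - \<psi> 0 \<partial>\<rho>)" using i by (simp add: prob_space)
    also have "\<bar>\<dots>\<bar> \<le> (\<integral>x. \<bar>\<psi> x - \<psi> 0\<bar> \<partial>\<rho>)" by (rule integral_abs_bound)
    also have "\<dots> \<le> (\<integral>x. x \<partial>\<rho>)"
      using i P1D(3,4)[OF that] g(3) by (intro integral_mono) auto
    finally show ?thesis .
  qed
  show "(\<integral>x. \<psi> x \<partial>\<mu>) - (\<integral>x. \<psi> x \<partial>\<nu>) \<le> (\<integral>x. x \<partial>\<mu>) + (\<integral>x. x \<partial>\<nu>)"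
    using *[OF assms(1)] *[OF assms(2)] by linarith
qed

lemma call_bounds:
  assumes "\<mu> \<in> P1" "K \<ge> 0"
  shows "integrable \<mu> (\<lambda>x. max (x - K) 0)"
    and "0 \<le> (\<integral>x. max (x - K) 0 \<partial>\<mu>)" "(\<integral>x. max (x - K) 0 \<partial>\<mu>) \<le> (\<integral>x. x \<partial>\<mu>)"
proof -
  have "linear_growth (\<lambda>x. max (x - K) 0)"
    unfolding linear_growth_def by (rule exI[of _ 1]) (use assms(2) in auto)
  then show i: "integrable \<mu> (\<lambda>x. max (x - K) 0)"
    by (intro integrable_P1_linear_growth[OF assms(1)] continuous_intros)
  show "0 \<le> (\<integral>x. max (x - K) 0 \<partial>\<mu>)" by (rule integral_nonneg_AE) simp
  show "(\<integral>x. max (x - K) 0 \<partial>\<mu>) \<le> (\<integral>x. x \<partial>\<mu>)"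
    using i P1D(3,4)[OF assms(1)] assms(2) by (intro integral_mono) auto
qed

lemma call_bdd_above:
  assumes "\<mu> \<in> P1" "\<nu> \<in> P1"
  shows "bdd_above ((\<lambda>K. (\<integral>x. max (x - K) 0 \<partial>\<mu>) - (\<integral>x. max (x - K) 0 \<partial>\<nu>)) ` {0..})"
proof (rule bdd_aboveI2)
  fix K :: real assume "K \<in> {0..}"
  then have "K \<ge> 0" by simp
  then show "(\<integral>x. max (x - K) 0 \<partial>\<mu>) - (\<integral>x. max (x - K) 0 \<partial>\<nu>) \<le> (\<integral>x. x \<partial>\<mu>)"
    using call_bounds(3)[OF assms(1), of K] call_bounds(2)[OF assms(2), of K] by linarith
qed

lemma couplings_nonempty:
  assumes "\<mu> \<in> P1" "\<nu> \<in> P1"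
  shows "\<mu> \<Otimes>\<^sub>M \<nu> \<in> couplings \<mu> \<nu>"
proof -
  interpret \<mu>: prob_space \<mu> using P1D(1)[OF assms(1)] .
  interpret \<nu>: prob_space \<nu> using P1D(1)[OF assms(2)] .
  interpret pair_prob_space \<mu> \<nu> ..
  have "distr (\<mu> \<Otimes>\<^sub>M \<nu>) \<nu> snd = \<nu>"
  proof (rule measure_eqI)
    fix A assume "A \<in> sets (distr (\<mu> \<Otimes>\<^sub>M \<nu>) \<nu> snd)"
    then have A: "A \<in> sets \<nu>" by simp
    have "snd -` A \<inter> space (\<mu> \<Otimes>\<^sub>M \<nu>) = space \<mu> \<times> A"
      using sets.sets_into_space[OF A] by (auto simp: space_pair_measure)
    then show "emeasure (distr (\<mu> \<Otimes>\<^sub>M \<nu>) \<nu> snd) A = emeasure \<nu> A"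
      using A by (simp add: emeasure_distr \<nu>.emeasure_pair_measure_Times \<mu>.emeasure_space_1)
  qed simp
  then show ?thesis by (simp add: couplings_def \<nu>.distr_pair_fst)
qed

lemma coupling_cost_integrable:
  assumes "\<mu> \<in> P1" "\<nu> \<in> P1" "\<pi> \<in> couplings \<mu> \<nu>"
  shows "integrable \<pi> (\<lambda>z. \<bar>fst z - snd z\<bar>)"
proof -
  have s[measurable_cong]: "sets \<pi> = sets (\<mu> \<Otimes>\<^sub>M \<nu>)" and f: "distr \<pi> \<mu> fst = \<mu>" and g: "distr \<pi> \<nu> snd = \<nu>"
    using assms(3) by (auto simp: couplings_def)
  have m: "fst \<in> measurable \<pi> \<mu>" "snd \<in> measurable \<pi> \<nu>" by measurable
  have "integrable \<pi> (\<lambda>z. fst z)"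
    by (rule integrable_distr[OF m(1)]) (use f P1D(4)[OF assms(1)] in simp)
  moreover have "integrable \<pi> (\<lambda>z. snd z)"
    by (rule integrable_distr[OF m(2)]) (use g P1D(4)[OF assms(2)] in simp)
  ultimately show ?thesis by simp
qed

end

theory Submission
  imports Defs
begin

text \<open>
  Everything is read off from the call prices \<open>C(K) = E[(X - K)\<^sup>+]\<close> and the distribution functions.
  Fubini gives \<open>E|X - Y| = \<integral> P(min X Y \<le> t < max X Y) dt\<close>, and with the quantile coupling
  \<open>W\<^sub>1(\<mu>,\<nu>) = \<integral> |F\<^sub>\<mu> - F\<^sub>\<nu>| dt\<close>. So the triangle inequality for \<open>W\<^sub>1\<close> needs no gluing of couplings.

  Closeness in \<open>d\<close> makes the call prices uniformly close, say within \<open>D\<close>. The difference quotients of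
  \<open>C\<close> with step \<open>h\<close> enclose \<open>F - 1\<close>, whence
  \<open>|F\<^sub>\<mu> - F\<^sub>\<nu>|(t) \<le> F\<^sub>\<mu>(t+h) - F\<^sub>\<mu>(t-h) + 2D/h\<close>. The first term integrates to \<open>2h\<close>; integrating over
  \<open>[0,K]\<close> and bounding the tail by \<open>C\<^sub>\<mu>(K) + C\<^sub>\<nu>(K)\<close> gives the equality of the topologies.

  A convex 1-Lipschitz function is, up to an affine part, a mixture of call payoffs of total mass at
  most 2 (its slope runs within \<open>[-1,1]\<close>). This gives the formula for equal barycenters; the extremal
  function is \<open>2 (x - K)\<^sup>+ - x\<close>.

  Uniform laws on interlacing even and odd grids are at \<open>W\<^sub>1\<close>-distance 1, but the difference of their
  integrals against \<open>\<psi>\<close> is an average of second differences of \<open>\<psi>\<close>, which telescopes.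
\<close>

subsection \<open>The directed distance and convex functions\<close>

text \<open>The strike \<open>K\<close> ranges over all reals: secants of the call price are also
  taken at \<open>t - h\<close>, which can be negative.\<close>

definition call :: "real measure \<Rightarrow> real \<Rightarrow> real" where
  "call \<mu> K = (\<integral>x. max (x - K) 0 \<partial>\<mu>)"

lemma integrable_convex_lip1: "\<mu> \<in> P1 \<Longrightarrow> \<psi> \<in> convex_lip1 \<Longrightarrow> integrable \<mu> \<psi>"
  using convex_lip1_linear_growth integrable_P1_linear_growth by blast

lemma directed_dist_upper:
  assumes "\<mu> \<in> P1" "\<nu> \<in> P1" "\<psi> \<in> convex_lip1"
  shows "(\<integral>x. \<psi> x \<partial>\<mu>) - (\<integral>x. \<psi> x \<partial>\<nu>) \<le> directed_dist \<mu> \<nu>"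
  using assms by (auto simp: directed_dist_def intro!: cSUP_upper directed_dist_bdd_above)

lemma directed_dist_least:
  assumes "\<mu> \<in> P1" "\<nu> \<in> P1"
    and "\<And>\<psi>. \<psi> \<in> convex_lip1 \<Longrightarrow> (\<integral>x. \<psi> x \<partial>\<mu>) - (\<integral>x. \<psi> x \<partial>\<nu>) \<le> B"
  shows "directed_dist \<mu> \<nu> \<le> B"
  using assms by (auto simp: directed_dist_def intro!: cSUP_least convex_lip1_nonempty)

lemma zero_in_convex_lip1: "(\<lambda>x. 0) \<in> convex_lip1"
  by (auto simp: convex_lip1_def convex_on_def lipschitz_on_def)

lemma directed_dist_nonneg: "0 \<le> directed_dist \<mu> \<nu>"
proof (cases "\<mu> \<in> P1 \<and> \<nu> \<in> P1")
  case True
  then show ?thesis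
    using directed_dist_upper[of \<mu> \<nu> "\<lambda>x. 0"] zero_in_convex_lip1 by simp
qed (auto simp: directed_dist_def)

lemma directed_dist_self: "directed_dist \<mu> \<mu> = 0"
proof (cases "\<mu> \<in> P1")
  case True
  then show ?thesis
    using directed_dist_least[of \<mu> \<mu> 0] directed_dist_nonneg[of \<mu> \<mu>] by force
qed (simp add: directed_dist_def)

lemma directed_dist_triangle:
  assumes "\<mu> \<in> P1" "\<nu> \<in> P1" "\<rho> \<in> P1"
  shows "directed_dist \<mu> \<rho> \<le> directed_dist \<mu> \<nu> + directed_dist \<nu> \<rho>"
  using assms(1,3)
proof (rule directed_dist_least)
  fix \<psi> assume "\<psi> \<in> convex_lip1"
  from directed_dist_upper[OF assms(1,2) this] directed_dist_upper[OF assms(2,3) this]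
  show "(\<integral>x. \<psi> x \<partial>\<mu>) - (\<integral>x. \<psi> x \<partial>\<rho>) \<le> directed_dist \<mu> \<nu> + directed_dist \<nu> \<rho>"
    by linarith
qed

lemma convex_on_call: "convex_on {0..} (\<lambda>x::real. max (x - K) 0)"
proof (rule convex_onI)
  fix t x y :: real
  assume t: "0 < t" "t < 1"
  have "(1 - t) * (x - K) + t * (y - K) \<le> (1 - t) * max (x - K) 0 + t * max (y - K) 0"
    using t by (intro add_mono mult_left_mono) auto
  moreover have "0 \<le> (1 - t) * max (x - K) 0 + t * max (y - K) 0"
    using t by simp
  moreover have "(1 - t) *\<^sub>R x + t *\<^sub>R y - K = (1 - t) * (x - K) + t * (y - K)"
    by (simp add: algebra_simps)
  ultimately show "max ((1 - t) *\<^sub>R x + t *\<^sub>R y - K) 0 \<le> (1 - t) * max (x - K) 0 + t * max (y - K) 0"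
    by simp
qed simp

lemma call_in_convex_lip1: "(\<lambda>x. max (x - K) 0) \<in> convex_lip1"
  using convex_on_call[of K] by (auto simp: convex_lip1_def lipschitz_on_def dist_real_def)

text \<open>This function is \<open>\<bar>x - K\<bar> - K\<close>, with slope -1 below
  \<open>K\<close> and +1 above, so it exhausts the slope range that the Lipschitz bound
  allows.\<close>

lemma straddle_in_convex_lip1: "(\<lambda>x. 2 * max (x - K) 0 - x) \<in> convex_lip1"
proof -
  have "concave_on {0..} (\<lambda>x::real. x)"
    by (auto simp: concave_on_def convex_on_def algebra_simps)
  then have "convex_on {0..} (\<lambda>x. 2 * max (x - K) 0 - x)"
    by (intro convex_on_diff convex_on_cmul convex_on_call) auto
  moreover have "\<bar>2 * max (x - K) 0 - x - (2 * max (y - K) 0 - y)\<bar> \<le> \<bar>x - y\<bar>" for x y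
    by (cases "x \<le> K"; cases "y \<le> K") auto
  ultimately show ?thesis
    by (auto simp: convex_lip1_def lipschitz_on_def dist_real_def)
qed

text \<open>One directed distance bounds the difference from above, the other from below, and by
  nonnegativity each is at most their sum. Uniformity in \<open>K\<close> is what is extracted below
  from closeness in \<open>bid_ask_dist\<close>.\<close>

lemma abs_call_diff_le:
  assumes "\<mu> \<in> P1" "\<nu> \<in> P1"
  shows "\<bar>call \<mu> K - call \<nu> K\<bar> \<le> 2 * bid_ask_dist \<mu> \<nu>"
proof -
  have "2 * bid_ask_dist \<mu> \<nu> = directed_dist \<mu> \<nu> + directed_dist \<nu> \<mu>"
    by (simp add: bid_ask_dist_def)
  then show ?thesis
    using directed_dist_upper[OF assms call_in_convex_lip1, of K, folded call_def]
    directed_dist_upper[OF assms(2,1) call_in_convex_lip1, of K, folded call_def]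
    directed_dist_nonneg[of \<mu> \<nu>] directed_dist_nonneg[of \<nu> \<mu>]
    by linarith
qed

text \<open>Both chords are compared with the chord over \<open>[a, d]\<close>, so
  \<open>[a, b]\<close> and \<open>[c, d]\<close> are allowed to overlap.\<close>

lemma convex_on_slope_mono:
  fixes f :: "real \<Rightarrow> real"
  assumes "convex_on A f" "a \<in> A" "d \<in> A" "a \<le> c" "b \<le> d" "a < b" "c < d"
  shows "(f b - f a) / (b - a) \<le> (f d - f c) / (d - c)"
proof -
  have "(f b - f a) / (b - a) \<le> (f d - f a) / (d - a)"
  proof (cases "b = d")
    case False
    with convex_on_slope_le(1)[OF assms(1-3), of b] assms show ?thesis
      by (metis le_less minus_diff_eq minus_divide_divide)
  qed simp
  also have "\<dots> \<le> (f d - f c) / (d - c)"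
  proof (cases "a = c")
    case False
    with convex_on_slope_le(2)[OF assms(1-3), of c] assms show ?thesis
      by (metis le_less minus_diff_eq minus_divide_divide)
  qed simp
  finally show ?thesis .
qed

subsection \<open>The Wasserstein distance and distribution functions\<close>

text \<open>The half-open interval from the minimum to the maximum has length
  \<open>\<bar>X z - Y z\<bar>\<close>; Tonelli exchanges the integrals. The same identity serves
  for coupling costs, for shifted distribution functions and for call prices.\<close>

lemma (in sigma_finite_measure) nn_integral_abs_diff:
  assumes [measurable]: "X \<in> borel_measurable M" "Y \<in> borel_measurable M"
  shows "(\<integral>\<^sup>+z. ennreal \<bar>X z - Y z\<bar> \<partial>M) =
    (\<integral>\<^sup>+t. emeasure M {z\<in>space M. min (X z) (Y z) \<le> t \<and> t < max (X z) (Y z)} \<partial>lborel)"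
proof -
  interpret pair_sigma_finite M lborel ..
  define f where "f = (\<lambda>(z, t). indicator {w\<in>space (M \<Otimes>\<^sub>M lborel).
     min (X (fst w)) (Y (fst w)) \<le> snd w \<and> snd w < max (X (fst w)) (Y (fst w))} (z, t) :: ennreal)"
  have f[measurable]: "f \<in> borel_measurable (M \<Otimes>\<^sub>M lborel)"
    unfolding f_def by measurable
  have "(\<integral>\<^sup>+z. ennreal \<bar>X z - Y z\<bar> \<partial>M) = (\<integral>\<^sup>+z. (\<integral>\<^sup>+t. f (z, t) \<partial>lborel) \<partial>M)"
  proof (intro nn_integral_cong)
    fix z assume z: "z \<in> space M"
    have "(\<integral>\<^sup>+t. f (z, t) \<partial>lborel) = (\<integral>\<^sup>+t. indicator {min (X z) (Y z)..<max (X z) (Y z)} t \<partial>lborel)"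
      using z by (intro nn_integral_cong) (auto simp: f_def space_pair_measure split: split_indicator)
    also have "\<dots> = ennreal (max (X z) (Y z) - min (X z) (Y z))"
      by (simp add: min_le_iff_disj le_max_iff_disj)
    also have "max (X z) (Y z) - min (X z) (Y z) = \<bar>X z - Y z\<bar>"
      by linarith
    finally show "ennreal \<bar>X z - Y z\<bar> = (\<integral>\<^sup>+t. f (z, t) \<partial>lborel)" ..
  qed
  also have "\<dots> = (\<integral>\<^sup>+t. (\<integral>\<^sup>+z. f (z, t) \<partial>M) \<partial>lborel)"
    by (rule Fubini'[symmetric]) simp
  also have "\<dots> = (\<integral>\<^sup>+t. emeasure M {z\<in>space M. min (X z) (Y z) \<le> t \<and> t < max (X z) (Y z)} \<partial>lborel)"
  proof (intro nn_integral_cong)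
    fix t :: real
    have "(\<integral>\<^sup>+z. f (z, t) \<partial>M) =
      (\<integral>\<^sup>+z. indicator {z\<in>space M. min (X z) (Y z) \<le> t \<and> t < max (X z) (Y z)} z \<partial>M)"
      by (intro nn_integral_cong) (auto simp: f_def space_pair_measure split: split_indicator)
    also have "\<dots> = emeasure M {z\<in>space M. min (X z) (Y z) \<le> t \<and> t < max (X z) (Y z)}"
      by (rule nn_integral_indicator) measurable
    finally show "(\<integral>\<^sup>+z. f (z, t) \<partial>M) = \<dots>" .
  qed
  finally show ?thesis .
qed

text \<open>The event on the right is the symmetric difference of the two events on the
  left.\<close>

lemma (in prob_space) abs_prob_diff_le:
  assumes [measurable]: "X \<in> borel_measurable M" "Y \<in> borel_measurable M"
  shows "\<bar>prob {z\<in>space M. X z \<le> (t::real)} - prob {z\<in>space M. Y z \<le> t}\<bar>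
    \<le> prob {z\<in>space M. min (X z) (Y z) \<le> t \<and> t < max (X z) (Y z)}"
proof -
  let ?A = "{z\<in>space M. X z \<le> t}" and ?B = "{z\<in>space M. Y z \<le> t}"
    and ?S = "{z\<in>space M. min (X z) (Y z) \<le> t \<and> t < max (X z) (Y z)}"
  have S: "?A \<in> events" "?B \<in> events" "?S \<in> events" by measurable
  have "?A \<subseteq> ?B \<union> ?S" "?B \<subseteq> ?A \<union> ?S" by auto
  then have "prob ?A \<le> prob (?B \<union> ?S)" "prob ?B \<le> prob (?A \<union> ?S)"
    using S by (auto intro!: finite_measure_mono)
  moreover have "prob (?B \<union> ?S) \<le> prob ?B + prob ?S" "prob (?A \<union> ?S) \<le> prob ?A + prob ?S"
    using S by (auto intro!: measure_Un_le)
  ultimately show ?thesis by linarith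
qed

text \<open>Measures in \<open>P1\<close> live on the sigma-algebra of the half-line. Pushing them
  forward along the inclusion makes the theory of \<open>cdf\<close> on the real line available, in
  particular its uniqueness theorem and the quantile function.\<close>

definition real_law :: "real measure \<Rightarrow> real measure" where
  "real_law \<mu> = distr \<mu> borel (\<lambda>x. x)"

lemma measurable_ident_P1: "\<mu> \<in> P1 \<Longrightarrow> (\<lambda>x. x) \<in> borel_measurable \<mu>"
  by (simp add: measurable_P1_continuous)

lemma real_distribution_real_law: "\<mu> \<in> P1 \<Longrightarrow> real_distribution (real_law \<mu>)"
  unfolding real_law_def
  by (intro prob_space.real_distribution_distr P1D(1) measurable_ident_P1)

lemma measurable_into_P1:
  "\<mu> \<in> P1 \<Longrightarrow> f \<in> measurable M \<mu> \<longleftrightarrow> f \<in> borel_measurable M \<and> f \<in> space M \<rightarrow> {0..}"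
  using measurable_cong_sets[OF refl P1D(2)[of \<mu>], of M] by (simp add: measurable_restrict_space2_iff)

lemma cdf_real_law:
  assumes "\<mu> \<in> P1"
  shows "cdf (real_law \<mu>) t = measure \<mu> {x\<in>space \<mu>. x \<le> t}"
  unfolding cdf_def real_law_def
  by (subst measure_distr) (auto simp: measurable_ident_P1[OF assms] intro!: arg_cong[where f="measure \<mu>"])

lemma cdf_real_law_neg: "\<mu> \<in> P1 \<Longrightarrow> t < 0 \<Longrightarrow> cdf (real_law \<mu>) t = 0"
  using P1D(3)[of \<mu>] by (simp add: cdf_real_law Collect_conj_eq[symmetric] cong: conj_cong)

text \<open>A measurable subset of the half-line is also Borel in the line and is its own preimage
  under the inclusion. Stated through sigma-algebras, the lemma applies to a pushforward whose law
  is still to be identified.\<close>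

lemma real_law_inject:
  assumes \<mu>: "sets \<mu> = sets (restrict_space borel {0..})"
    and \<nu>: "sets \<nu> = sets (restrict_space borel {0..})"
    and eq: "real_law \<mu> = real_law \<nu>"
  shows "\<mu> = \<nu>"
proof (rule measure_eqI)
  fix A assume A: "A \<in> sets \<mu>"
  then have [measurable]: "A \<in> sets borel"
    using \<mu> by (auto simp: sets_restrict_space)
  have *: "emeasure \<rho> A = emeasure (real_law \<rho>) A"
    if \<rho>: "sets \<rho> = sets (restrict_space borel {0..})" for \<rho>
  proof -
    have "(\<lambda>x. x) \<in> borel_measurable \<rho>"
      unfolding measurable_cong_sets[OF \<rho> refl] by (simp add: measurable_restrict_space1)
    moreover have "A \<subseteq> space \<rho>"
      using sets.sets_into_space[OF A] sets_eq_imp_space_eq[of \<mu> \<rho>] \<mu> \<rho> by simp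
    ultimately show ?thesis
      unfolding real_law_def by (subst emeasure_distr) (auto simp: Int_absorb2)
  qed
  show "emeasure \<mu> A = emeasure \<nu> A"
    using *[OF \<mu>] *[OF \<nu>] eq by simp
qed (use \<mu> \<nu> in simp)

lemma P1_eqI_cdf:
  "\<mu> \<in> P1 \<Longrightarrow> \<nu> \<in> P1 \<Longrightarrow> (\<And>t. cdf (real_law \<mu>) t = cdf (real_law \<nu>) t) \<Longrightarrow> \<mu> = \<nu>"
  by (rule real_law_inject[OF P1D(2) P1D(2)], assumption+, intro cdf_unique real_distribution_real_law ext)

lemma measurable_cdf_real_law [measurable]:
  assumes "\<mu> \<in> P1"
  shows "cdf (real_law \<mu>) \<in> borel_measurable borel"
proof -
  interpret real_distribution "real_law \<mu>" using real_distribution_real_law[OF assms] .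
  show ?thesis by (intro borel_measurable_mono monoI cdf_nondecreasing)
qed

section \<open>Couplings and the formula for the Wasserstein distance\<close>

lemma couplingsD:
  assumes "\<pi> \<in> couplings \<mu> \<nu>"
  shows "fst \<in> measurable \<pi> \<mu>" "snd \<in> measurable \<pi> \<nu>" "distr \<pi> \<mu> fst = \<mu>" "distr \<pi> \<nu> snd = \<nu>"
proof -
  have [measurable_cong]: "sets \<pi> = sets (\<mu> \<Otimes>\<^sub>M \<nu>)" using assms by (simp add: couplings_def)
  show "fst \<in> measurable \<pi> \<mu>" "snd \<in> measurable \<pi> \<nu>" by measurable
qed (use assms in \<open>auto simp: couplings_def\<close>)

lemma prob_space_coupling:
  assumes "\<mu> \<in> P1" "\<pi> \<in> couplings \<mu> \<nu>"
  shows "prob_space \<pi>"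
  using prob_space_distrD[OF couplingsD(1)[OF assms(2)]] couplingsD(3)[OF assms(2)] P1D(1)[OF assms(1)] by simp

text \<open>Under any coupling the distribution functions at \<open>t\<close> are the probabilities
  that the coordinates are at most \<open>t\<close>. They differ by at most the probability that
  \<open>t\<close> separates the coordinates, and this integrates to the cost.\<close>

lemma cdf_distance_le_coupling_cost:
  assumes \<mu>: "\<mu> \<in> P1" and \<nu>: "\<nu> \<in> P1" and \<pi>: "\<pi> \<in> couplings \<mu> \<nu>"
  shows "(\<integral>\<^sup>+t. ennreal \<bar>cdf (real_law \<mu>) t - cdf (real_law \<nu>) t\<bar> \<partial>lborel)
    \<le> ennreal (\<integral>z. \<bar>fst z - snd z\<bar> \<partial>\<pi>)"
proof -
  interpret prob_space \<pi> using prob_space_coupling[OF \<mu> \<pi>] .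
  note [measurable] = couplingsD(1,2)[OF \<pi>] measurable_ident_P1[OF \<mu>] measurable_ident_P1[OF \<nu>]
  have b[measurable]: "fst \<in> borel_measurable \<pi>" "snd \<in> borel_measurable \<pi>"
    using couplingsD(1,2)[OF \<pi>] by (simp_all add: measurable_into_P1[OF \<mu>] measurable_into_P1[OF \<nu>])
  have F: "cdf (real_law \<mu>) t = prob {z\<in>space \<pi>. fst z \<le> t}" for t
  proof -
    have "cdf (real_law \<mu>) t = measure (distr \<pi> \<mu> fst) {x\<in>space \<mu>. x \<le> t}"
      using couplingsD(3)[OF \<pi>] by (simp add: cdf_real_law[OF \<mu>])
    also have "\<dots> = prob {z\<in>space \<pi>. fst z \<le> t}"
      using measurable_space[OF couplingsD(1)[OF \<pi>]]
      by (subst measure_distr) (auto intro!: arg_cong[where f=prob])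
    finally show ?thesis .
  qed
  have G: "cdf (real_law \<nu>) t = prob {z\<in>space \<pi>. snd z \<le> t}" for t
  proof -
    have "cdf (real_law \<nu>) t = measure (distr \<pi> \<nu> snd) {x\<in>space \<nu>. x \<le> t}"
      using couplingsD(4)[OF \<pi>] by (simp add: cdf_real_law[OF \<nu>])
    also have "\<dots> = prob {z\<in>space \<pi>. snd z \<le> t}"
      using measurable_space[OF couplingsD(2)[OF \<pi>]]
      by (subst measure_distr) (auto intro!: arg_cong[where f=prob])
    finally show ?thesis .
  qed
  have "(\<integral>\<^sup>+t. ennreal \<bar>cdf (real_law \<mu>) t - cdf (real_law \<nu>) t\<bar> \<partial>lborel)
     \<le> (\<integral>\<^sup>+t. emeasure \<pi> {z\<in>space \<pi>. min (fst z) (snd z) \<le> t \<and> t < max (fst z) (snd z)} \<partial>lborel)"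
    unfolding F G emeasure_eq_measure
    by (intro nn_integral_mono ennreal_leI abs_prob_diff_le b)
  also have "\<dots> = (\<integral>\<^sup>+z. ennreal \<bar>fst z - snd z\<bar> \<partial>\<pi>)"
    by (rule nn_integral_abs_diff[OF b, symmetric])
  also have "\<dots> = ennreal (\<integral>z. \<bar>fst z - snd z\<bar> \<partial>\<pi>)"
    by (intro nn_integral_eq_integral coupling_cost_integrable[OF \<mu> \<nu> \<pi>]) simp
  finally show ?thesis .
qed

text \<open>Both quantile functions are driven by the same uniform variable \<open>w\<close>. Since
  \<open>X w \<le> t\<close> iff \<open>w\<close> is at most the distribution function at
  \<open>t\<close>, the level \<open>t\<close> separates \<open>X w\<close> and \<open>Y w\<close>
  only for \<open>w\<close> between the two values of the distribution functions.\<close>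

lemma quantile_coupling:
  assumes \<mu>: "\<mu> \<in> P1" and \<nu>: "\<nu> \<in> P1"
  obtains \<pi> where "\<pi> \<in> couplings \<mu> \<nu>"
    "ennreal (\<integral>z. \<bar>fst z - snd z\<bar> \<partial>\<pi>)
      \<le> (\<integral>\<^sup>+t. ennreal \<bar>cdf (real_law \<mu>) t - cdf (real_law \<nu>) t\<bar> \<partial>lborel)"
proof -
  let ?\<Omega> = "restrict_space lborel {0<..<1::real}"
  interpret \<Omega>: prob_space ?\<Omega>
    by (auto simp: space_restrict_space emeasure_restrict_space intro!: prob_spaceI)
  have q: "\<exists>Q. Q \<in> measurable ?\<Omega> \<rho> \<and> distr ?\<Omega> \<rho> Q = \<rho> \<and> Q \<in> borel_measurable ?\<Omega> \<and>
      (\<forall>w\<in>{0<..<1}. \<forall>x. w \<le> cdf (real_law \<rho>) x \<longleftrightarrow> Q w \<le> x)" if \<rho>: "\<rho> \<in> P1" for \<rho>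
  proof -
    interpret cdf_distribution "real_law \<rho>"
      unfolding cdf_distribution_def using real_distribution_real_law[OF \<rho>] .
    \<comment> \<open>A negative quantile would force the distribution function to be at least
      \<open>w > 0\<close> at a negative point, where it vanishes.\<close>
    have pos: "I w \<ge> 0" if "w \<in> {0<..<1}" for w
    proof (rule ccontr)
      assume "\<not> 0 \<le> I w"
      then have "w \<le> cdf (real_law \<rho>) (I w)" "cdf (real_law \<rho>) (I w) = 0"
        using that pseudoinverse[of w "I w"] cdf_real_law_neg[OF \<rho>, of "I w"] by auto
      with that show False by simp
    qed
    have b: "I \<in> borel_measurable ?\<Omega>"
      using measurable_CI by (simp cong: measurable_cong_sets add: sets_restrict_space)
    have m: "I \<in> measurable ?\<Omega> \<rho>"
      using b pos by (auto simp: measurable_into_P1[OF \<rho>] space_restrict_space)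
    \<comment> \<open>On the real line the pushforward under the quantile function is known;
      injectivity of \<open>real_law\<close> carries this back to the half-line.\<close>
    have "real_law (distr ?\<Omega> \<rho> I) = distr ?\<Omega> borel I"
      unfolding real_law_def[of "distr ?\<Omega> \<rho> I"]
      by (subst distr_distr[OF measurable_ident_P1[OF \<rho>] m]) (simp add: comp_def)
    also note distr_I_eq_M
    finally have "distr ?\<Omega> \<rho> I = \<rho>"
      using P1D(2)[OF \<rho>] by (intro real_law_inject[of "distr ?\<Omega> \<rho> I" \<rho>]) (simp, assumption+)
    with b m pseudoinverse' show ?thesis
      by (intro exI[of _ I] conjI) assumption+
  qed
  obtain X where X: "X \<in> measurable ?\<Omega> \<mu>" "distr ?\<Omega> \<mu> X = \<mu>" "X \<in> borel_measurable ?\<Omega>"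
    "\<And>w x. w \<in> {0<..<1} \<Longrightarrow> X w \<le> x \<longleftrightarrow> w \<le> cdf (real_law \<mu>) x"
    using q[OF \<mu>] by metis
  obtain Y where Y: "Y \<in> measurable ?\<Omega> \<nu>" "distr ?\<Omega> \<nu> Y = \<nu>" "Y \<in> borel_measurable ?\<Omega>"
    "\<And>w x. w \<in> {0<..<1} \<Longrightarrow> Y w \<le> x \<longleftrightarrow> w \<le> cdf (real_law \<nu>) x"
    using q[OF \<nu>] by metis
  note [measurable] = X(1,3) Y(1,3) measurable_ident_P1[OF \<mu>] measurable_ident_P1[OF \<nu>]
  define \<pi> where "\<pi> = distr ?\<Omega> (\<mu> \<Otimes>\<^sub>M \<nu>) (\<lambda>w. (X w, Y w))"
  have \<pi>: "\<pi> \<in> couplings \<mu> \<nu>"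
    using X(2) Y(2) by (simp add: couplings_def \<pi>_def distr_distr comp_def)
  have "ennreal (\<integral>z. \<bar>fst z - snd z\<bar> \<partial>\<pi>) = (\<integral>\<^sup>+z. ennreal \<bar>fst z - snd z\<bar> \<partial>\<pi>)"
    by (intro nn_integral_eq_integral[symmetric] coupling_cost_integrable[OF \<mu> \<nu> \<pi>]) simp
  also have "\<dots> = (\<integral>\<^sup>+w. ennreal \<bar>X w - Y w\<bar> \<partial>?\<Omega>)"
    unfolding \<pi>_def by (subst nn_integral_distr) auto
  also have "\<dots> = (\<integral>\<^sup>+t. emeasure ?\<Omega> {w\<in>space ?\<Omega>. min (X w) (Y w) \<le> t \<and> t < max (X w) (Y w)} \<partial>lborel)"
    by (rule \<Omega>.nn_integral_abs_diff[OF X(3) Y(3)])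
  also have "\<dots> \<le> (\<integral>\<^sup>+t. ennreal \<bar>cdf (real_law \<mu>) t - cdf (real_law \<nu>) t\<bar> \<partial>lborel)"
  proof (intro nn_integral_mono)
    fix t
    let ?F = "cdf (real_law \<mu>) t" and ?G = "cdf (real_law \<nu>) t"
    let ?S = "{w\<in>space ?\<Omega>. min (X w) (Y w) \<le> t \<and> t < max (X w) (Y w)}"
    have S: "?S \<subseteq> {0<..<1}" by (auto simp: space_restrict_space)
    have "?S \<in> sets ?\<Omega>" by measurable
    then have "emeasure ?\<Omega> ?S = emeasure lborel ?S"
      using S by (subst emeasure_restrict_space) auto
    \<comment> \<open>The closed interval has the same length as the half-open one that contains the
      separating \<open>w\<close>.\<close>
    also have "\<dots> \<le> emeasure lborel {min ?F ?G..max ?F ?G}"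
      using X(4)[of _ t] Y(4)[of _ t]
      by (intro emeasure_mono) (fastforce simp: space_restrict_space min_le_iff_disj less_max_iff_disj not_le[symmetric])+
    also have "\<dots> = ennreal (max ?F ?G - min ?F ?G)"
      by (simp add: min_le_iff_disj le_max_iff_disj)
    also have "max ?F ?G - min ?F ?G = \<bar>?F - ?G\<bar>" by linarith
    finally show "emeasure ?\<Omega> ?S \<le> ennreal \<bar>?F - ?G\<bar>" .
  qed
  finally show thesis using that \<pi> by blast
qed

lemma wasserstein1_nonneg: "0 \<le> wasserstein1 \<mu> \<nu>"
  unfolding wasserstein1_def
  using couplings_nonempty by (auto intro!: cINF_greatest)

text \<open>The quantile coupling attains the lower bound valid for every coupling, so the infimum
  is a minimum.\<close>

lemma wasserstein1_eq_cdf: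
  assumes "\<mu> \<in> P1" "\<nu> \<in> P1"
  shows "ennreal (wasserstein1 \<mu> \<nu>) =
    (\<integral>\<^sup>+t. ennreal \<bar>cdf (real_law \<mu>) t - cdf (real_law \<nu>) t\<bar> \<partial>lborel)"
proof -
  let ?W = "\<integral>\<^sup>+t. ennreal \<bar>cdf (real_law \<mu>) t - cdf (real_law \<nu>) t\<bar> \<partial>lborel"
  obtain \<pi> where \<pi>: "\<pi> \<in> couplings \<mu> \<nu>" "ennreal (\<integral>z. \<bar>fst z - snd z\<bar> \<partial>\<pi>) \<le> ?W"
    using quantile_coupling[OF assms] .
  then have eq: "ennreal (\<integral>z. \<bar>fst z - snd z\<bar> \<partial>\<pi>) = ?W"
    using cdf_distance_le_coupling_cost[OF assms] by (auto intro: antisym)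
  have "wasserstein1 \<mu> \<nu> = (\<integral>z. \<bar>fst z - snd z\<bar> \<partial>\<pi>)"
    unfolding wasserstein1_def using assms
  proof (simp, intro cInf_eq_minimum)
    fix x assume "x \<in> (\<lambda>\<pi>. \<integral>z. \<bar>fst z - snd z\<bar> \<partial>\<pi>) ` couplings \<mu> \<nu>"
    then obtain \<pi>' where "\<pi>' \<in> couplings \<mu> \<nu>" and x: "x = (\<integral>z. \<bar>fst z - snd z\<bar> \<partial>\<pi>')" by auto
    from cdf_distance_le_coupling_cost[OF assms this(1)]
    have "ennreal (\<integral>z. \<bar>fst z - snd z\<bar> \<partial>\<pi>) \<le> ennreal x" by (simp add: eq x)
    then show "(\<integral>z. \<bar>fst z - snd z\<bar> \<partial>\<pi>) \<le> x" by (simp add: x)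
  qed (use \<pi> in auto)
  then show ?thesis by (simp add: eq)
qed

lemma wasserstein1_commute: "wasserstein1 \<mu> \<nu> = wasserstein1 \<nu> \<mu>"
proof (cases "\<mu> \<in> P1 \<and> \<nu> \<in> P1")
  case True
  then have "ennreal (wasserstein1 \<mu> \<nu>) = ennreal (wasserstein1 \<nu> \<mu>)"
    by (simp add: wasserstein1_eq_cdf abs_minus_commute)
  then show ?thesis by (simp add: wasserstein1_nonneg)
qed (auto simp: wasserstein1_def)

text \<open>The distance is the L1 distance of the distribution functions, where the inequality
  holds pointwise.\<close>

lemma wasserstein1_triangle:
  assumes \<mu>: "\<mu> \<in> P1" and \<nu>: "\<nu> \<in> P1" and \<rho>: "\<rho> \<in> P1"
  shows "wasserstein1 \<mu> \<rho> \<le> wasserstein1 \<mu> \<nu> + wasserstein1 \<nu> \<rho>"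
proof -
  note [measurable] = measurable_cdf_real_law[OF \<mu>] measurable_cdf_real_law[OF \<nu>] measurable_cdf_real_law[OF \<rho>]
  let ?F = "cdf (real_law \<mu>)" and ?G = "cdf (real_law \<nu>)" and ?H = "cdf (real_law \<rho>)"
  have "ennreal (wasserstein1 \<mu> \<rho>) = (\<integral>\<^sup>+t. ennreal \<bar>?F t - ?H t\<bar> \<partial>lborel)"
    by (rule wasserstein1_eq_cdf[OF \<mu> \<rho>])
  also have "\<dots> \<le> (\<integral>\<^sup>+t. ennreal \<bar>?F t - ?G t\<bar> + ennreal \<bar>?G t - ?H t\<bar> \<partial>lborel)"
    by (intro nn_integral_mono) (auto simp flip: ennreal_plus intro!: ennreal_leI)
  also have "\<dots> = ennreal (wasserstein1 \<mu> \<nu>) + ennreal (wasserstein1 \<nu> \<rho>)"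
    by (subst nn_integral_add) (auto simp: wasserstein1_eq_cdf \<mu> \<nu> \<rho>)
  finally show ?thesis
    by (simp add: wasserstein1_nonneg flip: ennreal_plus)
qed

text \<open>The easy half of Kantorovich duality: under any coupling the difference of the integrals
  is the integral of \<open>\<psi> (fst z) - \<psi> (snd z)\<close>, which is at most the
  cost.\<close>

lemma directed_dist_le_wasserstein1:
  assumes \<mu>: "\<mu> \<in> P1" and \<nu>: "\<nu> \<in> P1"
  shows "directed_dist \<mu> \<nu> \<le> wasserstein1 \<mu> \<nu>"
proof (rule directed_dist_least[OF \<mu> \<nu>])
  fix \<psi> assume \<psi>: "\<psi> \<in> convex_lip1"
  have "(\<integral>x. \<psi> x \<partial>\<mu>) - (\<integral>x. \<psi> x \<partial>\<nu>) \<le> (\<integral>z. \<bar>fst z - snd z\<bar> \<partial>\<pi>)" if \<pi>: "\<pi> \<in> couplings \<mu> \<nu>" for \<pi>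
  proof -
    note m = couplingsD[OF \<pi>]
    note i = integrable_convex_lip1[OF \<mu> \<psi>] integrable_convex_lip1[OF \<nu> \<psi>]
    have *: "integrable \<pi> (\<lambda>z. \<psi> (fst z))" "integrable \<pi> (\<lambda>z. \<psi> (snd z))"
      by (rule integrable_distr[OF m(1)], use i m in simp) (rule integrable_distr[OF m(2)], use i m in simp)
    have "(\<integral>x. \<psi> x \<partial>\<mu>) = (\<integral>z. \<psi> (fst z) \<partial>\<pi>)"
      using integral_distr[OF m(1), of \<psi>] i(1) m(3) by (simp add: borel_measurable_integrable)
    moreover have "(\<integral>x. \<psi> x \<partial>\<nu>) = (\<integral>z. \<psi> (snd z) \<partial>\<pi>)"
      using integral_distr[OF m(2), of \<psi>] i(2) m(4) by (simp add: borel_measurable_integrable)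
    ultimately have "(\<integral>x. \<psi> x \<partial>\<mu>) - (\<integral>x. \<psi> x \<partial>\<nu>) = (\<integral>z. \<psi> (fst z) - \<psi> (snd z) \<partial>\<pi>)"
      using * by simp
    also have "\<dots> \<le> (\<integral>z. \<bar>fst z - snd z\<bar> \<partial>\<pi>)"
    proof (rule integral_mono)
      fix z assume "z \<in> space \<pi>"
      then have "fst z \<ge> 0" "snd z \<ge> 0"
        using measurable_space[OF m(1)] measurable_space[OF m(2)] P1D(3)[OF \<mu>] P1D(3)[OF \<nu>] by auto
      then show "\<psi> (fst z) - \<psi> (snd z) \<le> \<bar>fst z - snd z\<bar>"
        using \<psi> lipschitz_onD[of 1 "{0..}" \<psi> "fst z" "snd z"]
        by (auto simp: convex_lip1_def dist_real_def)
    qed (use * coupling_cost_integrable[OF \<mu> \<nu> \<pi>] in auto)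
    finally show ?thesis .
  qed
  then show "(\<integral>x. \<psi> x \<partial>\<mu>) - (\<integral>x. \<psi> x \<partial>\<nu>) \<le> wasserstein1 \<mu> \<nu>"
    using \<mu> \<nu> couplings_nonempty[OF \<mu> \<nu>] unfolding wasserstein1_def by (auto intro!: cINF_greatest)
qed

lemma bid_ask_dist_le_wasserstein1:
  assumes "\<mu> \<in> P1" "\<nu> \<in> P1"
  shows "bid_ask_dist \<mu> \<nu> \<le> wasserstein1 \<mu> \<nu>"
  using directed_dist_le_wasserstein1[OF assms] directed_dist_le_wasserstein1[OF assms(2,1)]
  by (simp add: bid_ask_dist_def wasserstein1_commute[of \<nu> \<mu>])

subsection \<open>Call prices and the topology\<close>

lemma integrable_call: "\<mu> \<in> P1 \<Longrightarrow> integrable \<mu> (\<lambda>x. max (x - K) 0)"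
  using integrable_convex_lip1 call_in_convex_lip1 by blast

text \<open>The difference of the payoffs with strikes \<open>t\<close> and \<open>t + h\<close>
  lies between \<open>h\<close> times the indicators of \<open>x > t + h\<close> and of
  \<open>x > t\<close>.\<close>

lemma call_diff_bounds:
  assumes \<mu>: "\<mu> \<in> P1" and h: "h > 0"
  shows "h * (1 - cdf (real_law \<mu>) (t + h)) \<le> call \<mu> t - call \<mu> (t + h)"
    and "call \<mu> t - call \<mu> (t + h) \<le> h * (1 - cdf (real_law \<mu>) t)"
proof -
  interpret prob_space \<mu> using P1D(1)[OF \<mu>] .
  note [measurable] = measurable_ident_P1[OF \<mu>]
  have tail: "1 - cdf (real_law \<mu>) s = prob {x\<in>space \<mu>. s < x}" for s
  proof -
    have "{x\<in>space \<mu>. s < x} = space \<mu> - {x\<in>space \<mu>. x \<le> s}" by auto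
    then show ?thesis
      by (simp add: cdf_real_law[OF \<mu>] prob_compl)
  qed
  have i: "integrable \<mu> (\<lambda>x. h * indicator {x\<in>space \<mu>. s < x} x)" for s
    by (intro integrable_mult_right integrable_real_indicator) (auto simp: emeasure_eq_measure)
  have e: "(\<integral>x. h * indicator {x\<in>space \<mu>. s < x} x \<partial>\<mu>) = h * (1 - cdf (real_law \<mu>) s)" for s
    by (simp add: tail Int_absorb2 subset_eq)
  have c: "call \<mu> t - call \<mu> (t + h) = (\<integral>x. max (x - t) 0 - max (x - (t + h)) 0 \<partial>\<mu>)"
    unfolding call_def by (rule Bochner_Integration.integral_diff[symmetric]) (rule integrable_call[OF \<mu>])+
  show "h * (1 - cdf (real_law \<mu>) (t + h)) \<le> call \<mu> t - call \<mu> (t + h)"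
    unfolding c e[symmetric] using h
    by (intro integral_mono i Bochner_Integration.integrable_diff integrable_call[OF \<mu>])
       (auto split: split_indicator)
  show "call \<mu> t - call \<mu> (t + h) \<le> h * (1 - cdf (real_law \<mu>) t)"
    unfolding c e[symmetric] using h
    by (intro integral_mono i Bochner_Integration.integrable_diff integrable_call[OF \<mu>])
       (auto split: split_indicator)
qed

text \<open>The integrand is the probability that \<open>t\<close> lies between \<open>x - h\<close>
  and \<open>x + h\<close>, an interval of length \<open>2 * h\<close> for every
  \<open>x\<close>.\<close>

lemma nn_integral_cdf_shift:
  assumes "\<mu> \<in> P1" "h > 0"
  shows "(\<integral>\<^sup>+t. ennreal (cdf (real_law \<mu>) (t + h) - cdf (real_law \<mu>) (t - h)) \<partial>lborel) = ennreal (2 * h)"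
proof -
  interpret prob_space \<mu> using P1D(1)[OF assms(1)] .
  note [measurable] = measurable_ident_P1[OF assms(1)]
  have "(\<integral>\<^sup>+x. ennreal \<bar>(x - h) - (x + h)\<bar> \<partial>\<mu>) =
     (\<integral>\<^sup>+t. emeasure \<mu> {x\<in>space \<mu>. min (x - h) (x + h) \<le> t \<and> t < max (x - h) (x + h)} \<partial>lborel)"
    by (rule nn_integral_abs_diff) measurable
  also have "\<dots> = (\<integral>\<^sup>+t. ennreal (cdf (real_law \<mu>) (t + h) - cdf (real_law \<mu>) (t - h)) \<partial>lborel)"
  proof (intro nn_integral_cong)
    fix t
    have "{x\<in>space \<mu>. min (x - h) (x + h) \<le> t \<and> t < max (x - h) (x + h)} =
      {x\<in>space \<mu>. x \<le> t + h} - {x\<in>space \<mu>. x \<le> t - h}"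
      using assms(2) by auto
    moreover have "prob ({x\<in>space \<mu>. x \<le> t + h} - {x\<in>space \<mu>. x \<le> t - h}) =
       prob {x\<in>space \<mu>. x \<le> t + h} - prob {x\<in>space \<mu>. x \<le> t - h}"
      using assms(2) by (intro finite_measure_Diff) auto
    ultimately show "emeasure \<mu> {x\<in>space \<mu>. min (x - h) (x + h) \<le> t \<and> t < max (x - h) (x + h)} =
      ennreal (cdf (real_law \<mu>) (t + h) - cdf (real_law \<mu>) (t - h))"
      by (simp add: emeasure_eq_measure cdf_real_law[OF assms(1)])
  qed
  finally show ?thesis
    using assms(2) by (simp add: emeasure_space_1)
qed

text \<open>The Fubini identity is applied to \<open>max x K\<close> and the constant
  \<open>K\<close>, so that only levels from \<open>K\<close> on contribute.\<close>

lemma nn_integral_tail_eq_call: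
  assumes "\<mu> \<in> P1"
  shows "(\<integral>\<^sup>+t. ennreal (1 - cdf (real_law \<mu>) t) * indicator {K..} t \<partial>lborel) = ennreal (call \<mu> K)"
proof -
  interpret prob_space \<mu> using P1D(1)[OF assms(1)] .
  note [measurable] = measurable_ident_P1[OF assms(1)]
  have "ennreal (call \<mu> K) = (\<integral>\<^sup>+x. ennreal \<bar>max x K - K\<bar> \<partial>\<mu>)"
  proof -
    have "\<bar>max x K - K\<bar> = max (x - K) 0" for x by simp
    then show ?thesis
      unfolding call_def
      by (simp only:) (rule nn_integral_eq_integral[OF integrable_call[OF assms], symmetric], simp)
  qed
  also have "\<dots> = (\<integral>\<^sup>+t. emeasure \<mu> {x\<in>space \<mu>. min (max x K) K \<le> t \<and> t < max (max x K) K} \<partial>lborel)"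
    by (rule nn_integral_abs_diff) measurable
  also have "\<dots> = (\<integral>\<^sup>+t. ennreal (1 - cdf (real_law \<mu>) t) * indicator {K..} t \<partial>lborel)"
  proof (intro nn_integral_cong)
    fix t
    have "{x\<in>space \<mu>. min (max x K) K \<le> t \<and> t < max (max x K) K} =
      (if K \<le> t then space \<mu> - {x\<in>space \<mu>. x \<le> t} else {})"
      by auto
    then show "emeasure \<mu> {x\<in>space \<mu>. min (max x K) K \<le> t \<and> t < max (max x K) K} =
      ennreal (1 - cdf (real_law \<mu>) t) * indicator {K..} t"
      by (simp add: emeasure_eq_measure cdf_real_law[OF assms(1)] prob_compl split: split_indicator)
  qed
  finally show ?thesis ..
qed

text \<open>The value of \<open>1 - cdf\<close> at \<open>t\<close> lies between secant slopes of
  the call price to the right and to the left of \<open>t\<close>. Replacing one measure by the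
  other changes a secant over length \<open>h\<close> by at most \<open>2 * D / h\<close>, one
  \<open>D\<close> for each end.\<close>

lemma cdf_diff_le_of_call:
  assumes \<mu>: "\<mu> \<in> P1" and \<nu>: "\<nu> \<in> P1" and h: "h > 0"
    and D: "\<And>K. \<bar>call \<mu> K - call \<nu> K\<bar> \<le> D"
  shows "\<bar>cdf (real_law \<mu>) t - cdf (real_law \<nu>) t\<bar>
    \<le> cdf (real_law \<mu>) (t + h) - cdf (real_law \<mu>) (t - h) + 2 * D / h"
proof -
  let ?F = "cdf (real_law \<mu>)" and ?G = "cdf (real_law \<nu>)"
  interpret \<mu>: real_distribution "real_law \<mu>" using real_distribution_real_law[OF \<mu>] .
  have mono: "?F (t - h) \<le> ?F t" "?F t \<le> ?F (t + h)"
    using h by (auto intro: \<mu>.cdf_nondecreasing)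
  have "h * (1 - ?G t) \<ge> h * (1 - ?F (t + h)) - 2 * D"
    using call_diff_bounds(1)[OF \<mu> h, of t] call_diff_bounds(2)[OF \<nu> h, of t] D[of t] D[of "t + h"]
    by linarith
  then have 1: "?G t \<le> ?F (t + h) + 2 * D / h"
    using h by (simp add: field_simps)
  have "h * (1 - ?G t) \<le> h * (1 - ?F (t - h)) + 2 * D"
    using call_diff_bounds(2)[OF \<mu> h, of "t - h"] call_diff_bounds(1)[OF \<nu> h, of "t - h"] D[of t] D[of "t - h"]
    by simp
  then have 2: "?F (t - h) - 2 * D / h \<le> ?G t"
    using h by (simp add: field_simps)
  show ?thesis using mono 1 2 by linarith
qed

text \<open>The line is split at 0 and \<open>K\<close>: below 0 both distribution functions vanish,
  on the middle part the call prices control their difference, and beyond \<open>K\<close> the two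
  tails integrate to call prices.\<close>

lemma wasserstein1_le_of_call:
  assumes \<mu>: "\<mu> \<in> P1" and \<nu>: "\<nu> \<in> P1" and h: "h > 0" and K: "K \<ge> 0"
    and D: "\<And>K. \<bar>call \<mu> K - call \<nu> K\<bar> \<le> D"
  shows "wasserstein1 \<mu> \<nu> \<le> 2 * h + 2 * D / h * K + (call \<mu> K + call \<nu> K)"
proof -
  let ?F = "cdf (real_law \<mu>)" and ?G = "cdf (real_law \<nu>)"
  interpret \<mu>: real_distribution "real_law \<mu>" using real_distribution_real_law[OF \<mu>] .
  interpret \<nu>: real_distribution "real_law \<nu>" using real_distribution_real_law[OF \<nu>] .
  note [measurable] = measurable_cdf_real_law[OF \<mu>] measurable_cdf_real_law[OF \<nu>]
  have D0: "0 \<le> D" using D[of 0] by linarith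
  have c0: "0 \<le> call \<rho> K" for \<rho>
    unfolding call_def by (rule integral_nonneg_AE) simp
  have shift0: "0 \<le> ?F (t + h) - ?F (t - h)" for t
    using h by (auto intro: \<mu>.cdf_nondecreasing)
  \<comment> \<open>The term \<open>a\<close> is spread over the whole line, where its integral is
    exactly \<open>2 * h\<close>; the constant in \<open>b\<close> has to be confined to
    \<open>{0..K}\<close> to have a finite integral.\<close>
  define a where "a t = ennreal (?F (t + h) - ?F (t - h))" for t
  define b where "b t = ennreal (2 * D / h) * indicator {0..K} t" for t
  define c where "c t = ennreal (1 - ?F t) * indicator {K..} t + ennreal (1 - ?G t) * indicator {K..} t" for t
  have meas[measurable]: "a \<in> borel_measurable lborel" "b \<in> borel_measurable lborel" "c \<in> borel_measurable lborel"
    unfolding a_def b_def c_def by measurable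
  have "ennreal (wasserstein1 \<mu> \<nu>) = (\<integral>\<^sup>+t. ennreal \<bar>?F t - ?G t\<bar> \<partial>lborel)"
    by (rule wasserstein1_eq_cdf[OF \<mu> \<nu>])
  also have "\<dots> \<le> (\<integral>\<^sup>+t. a t + b t + c t \<partial>lborel)"
  proof (intro nn_integral_mono)
    fix t
    consider "t < 0" | "t \<in> {0..K}" | "t \<in> {K..}" by force
    then show "ennreal \<bar>?F t - ?G t\<bar> \<le> a t + b t + c t"
    proof cases
      case 1
      then show ?thesis by (simp add: cdf_real_law_neg[OF \<mu>] cdf_real_law_neg[OF \<nu>])
    next
      case 2
      have "ennreal \<bar>?F t - ?G t\<bar> \<le> a t + b t"
        using cdf_diff_le_of_call[OF \<mu> \<nu> h D, of t] 2 shift0[of t] D0 h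
        by (auto simp: a_def b_def simp flip: ennreal_plus intro!: ennreal_leI)
      then show ?thesis by (rule order_trans) simp
    next
      case 3
      have "ennreal \<bar>?F t - ?G t\<bar> \<le> c t"
        using 3 \<mu>.cdf_bounded_prob[of t] \<nu>.cdf_bounded_prob[of t]
        by (auto simp: c_def simp flip: ennreal_plus intro!: ennreal_leI)
      then show ?thesis by (rule order_trans) simp
    qed
  qed
  also have "\<dots> = (\<integral>\<^sup>+t. a t \<partial>lborel) + (\<integral>\<^sup>+t. b t \<partial>lborel) + (\<integral>\<^sup>+t. c t \<partial>lborel)"
    by (simp add: nn_integral_add)
  also have "(\<integral>\<^sup>+t. a t \<partial>lborel) = ennreal (2 * h)"
    unfolding a_def by (rule nn_integral_cdf_shift[OF \<mu> h])
  also have "(\<integral>\<^sup>+t. b t \<partial>lborel) = ennreal (2 * D / h * K)"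
    unfolding b_def using K D0 h by (simp add: nn_integral_cmult flip: ennreal_mult)
  also have "(\<integral>\<^sup>+t. c t \<partial>lborel) = ennreal (call \<mu> K + call \<nu> K)"
    unfolding c_def by (simp add: nn_integral_add nn_integral_tail_eq_call \<mu> \<nu> ennreal_plus c0)
  also have "ennreal (2 * h) + ennreal (2 * D / h * K) + ennreal (call \<mu> K + call \<nu> K)
     = ennreal (2 * h + 2 * D / h * K + (call \<mu> K + call \<nu> K))"
    using h D0 K c0 by (simp flip: ennreal_plus)
  finally show ?thesis
    using h D0 K c0[of \<mu>] c0[of \<nu>] by (subst (asm) ennreal_le_iff) auto
qed

lemma call_tendsto_0:
  assumes "\<mu> \<in> P1"
  shows "(call \<mu> \<longlongrightarrow> 0) at_top"
proof -
  have "((\<lambda>K. \<integral>x. max (x - K) 0 \<partial>\<mu>) \<longlongrightarrow> (\<integral>x. 0 \<partial>\<mu>)) at_top"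
  proof (rule integral_dominated_convergence_at_top[where w="\<lambda>x. x"])
    show "AE x in \<mu>. ((\<lambda>K. max (x - K) 0) \<longlongrightarrow> 0) at_top"
    proof (rule AE_I2)
      fix x :: real
      show "((\<lambda>K. max (x - K) 0) \<longlongrightarrow> 0) at_top"
        by (intro tendsto_eventually eventually_mono[OF eventually_ge_at_top[of x]]) simp
    qed
    show "\<forall>\<^sub>F K in at_top. AE x in \<mu>. norm (max (x - K) 0) \<le> x"
      by (rule eventually_mono[OF eventually_ge_at_top[of 0]]) (auto simp: P1D(3)[OF assms] intro!: AE_I2)
  qed (use P1D[OF assms] integrable_call[OF assms] in \<open>auto simp: borel_measurable_integrable\<close>)
  then show ?thesis by (simp add: call_def[abs_def])
qed

section \<open>Separation of points, the two metrics and their topologies\<close>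

text \<open>At distance 0 the call prices agree. A common secant over \<open>[t, s]\<close> then
  shows that one distribution function at \<open>t\<close> is at most the other at \<open>s\<close>;
  right-continuity lets \<open>s\<close> decrease to \<open>t\<close>, and the roles are
  exchanged.\<close>

lemma bid_ask_dist_eq_0_imp_eq:
  assumes \<mu>: "\<mu> \<in> P1" and \<nu>: "\<nu> \<in> P1" and "bid_ask_dist \<mu> \<nu> = 0"
  shows "\<mu> = \<nu>"
proof (rule P1_eqI_cdf[OF \<mu> \<nu>])
  have c: "call \<mu> K = call \<nu> K" for K
    using abs_call_diff_le[OF \<mu> \<nu>, of K] assms(3) by simp
  have le: "cdf (real_law \<rho>) t \<le> cdf (real_law \<sigma>) t"
    if \<rho>: "\<rho> \<in> P1" and \<sigma>: "\<sigma> \<in> P1" and eq: "\<And>K. call \<rho> K = call \<sigma> K" for \<rho> \<sigma> t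
  proof -
    interpret \<sigma>: real_distribution "real_law \<sigma>" using real_distribution_real_law[OF \<sigma>] .
    have "cdf (real_law \<rho>) t \<le> cdf (real_law \<sigma>) s" if "t < s" for s
    proof -
      define h where "h = s - t"
      have h: "h > 0" "s = t + h" using that by (auto simp: h_def)
      have "h * (1 - cdf (real_law \<sigma>) s) \<le> h * (1 - cdf (real_law \<rho>) t)"
        using call_diff_bounds(2)[OF \<rho> h(1), of t] call_diff_bounds(1)[OF \<sigma> h(1), of t] h(2)
        by (simp add: eq)
      then show ?thesis using h(1) by simp
    qed
    then have "eventually (\<lambda>s. cdf (real_law \<rho>) t \<le> cdf (real_law \<sigma>) s) (at_right t)"
      by (auto simp: eventually_at_filter)
    moreover have "(cdf (real_law \<sigma>) \<longlongrightarrow> cdf (real_law \<sigma>) t) (at_right t)"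
      using \<sigma>.cdf_is_right_cont by (simp add: continuous_within)
    ultimately show ?thesis
      by (intro tendsto_lowerbound) auto
  qed
  show "cdf (real_law \<mu>) t = cdf (real_law \<nu>) t" for t
    using le[OF \<mu> \<nu>, of t] le[OF \<nu> \<mu>, of t] c by force
qed

lemma Metric_space_bid_ask: "Metric_space P1 bid_ask_dist"
proof
  show "0 \<le> bid_ask_dist \<mu> \<nu>" for \<mu> \<nu>
    by (simp add: bid_ask_dist_def directed_dist_nonneg)
  show "bid_ask_dist \<mu> \<nu> = bid_ask_dist \<nu> \<mu>" for \<mu> \<nu>
    by (simp add: bid_ask_dist_def)
  show "bid_ask_dist \<mu> \<nu> = 0 \<longleftrightarrow> \<mu> = \<nu>" if "\<mu> \<in> P1" "\<nu> \<in> P1" for \<mu> \<nu>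
    using bid_ask_dist_eq_0_imp_eq[OF that] by (auto simp: bid_ask_dist_def directed_dist_self)
  show "bid_ask_dist \<mu> \<rho> \<le> bid_ask_dist \<mu> \<nu> + bid_ask_dist \<nu> \<rho>"
    if "\<mu> \<in> P1" "\<nu> \<in> P1" "\<rho> \<in> P1" for \<mu> \<nu> \<rho>
    using directed_dist_triangle[of \<mu> \<nu> \<rho>] directed_dist_triangle[of \<rho> \<nu> \<mu>] that
    by (simp add: bid_ask_dist_def field_simps)
qed

lemma wasserstein1_self: "wasserstein1 \<mu> \<mu> = 0"
proof (cases "\<mu> \<in> P1")
  case True
  then have "ennreal (wasserstein1 \<mu> \<mu>) = 0" by (simp add: wasserstein1_eq_cdf)
  then show ?thesis using wasserstein1_nonneg[of \<mu> \<mu>] by simp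
qed (simp add: wasserstein1_def)

text \<open>Separation is inherited from the smaller metric \<open>bid_ask_dist\<close>.\<close>

lemma Metric_space_wasserstein1: "Metric_space P1 wasserstein1"
proof
  show "wasserstein1 \<mu> \<nu> = 0 \<longleftrightarrow> \<mu> = \<nu>" if "\<mu> \<in> P1" "\<nu> \<in> P1" for \<mu> \<nu>
  proof
    assume "wasserstein1 \<mu> \<nu> = 0"
    then have "bid_ask_dist \<mu> \<nu> = 0"
      using bid_ask_dist_le_wasserstein1[OF that] Metric_space.nonneg[OF Metric_space_bid_ask]
      by (metis order_antisym)
    then show "\<mu> = \<nu>" by (rule bid_ask_dist_eq_0_imp_eq[OF that])
  qed (simp add: wasserstein1_self)
qed (use wasserstein1_nonneg wasserstein1_commute wasserstein1_triangle in auto)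

text \<open>The cutoff \<open>K\<close> is chosen from the tail of \<mu> alone; closeness of the
  call prices at \<open>K\<close> then controls the tail of \<nu>. The radius depends on \<mu>, and
  the interlacing grids below show that no radius serves all \<mu> at once.\<close>

lemma wasserstein1_small_of_bid_ask_small:
  assumes \<mu>: "\<mu> \<in> P1" and "e > 0"
  obtains r where "r > 0" "\<And>\<nu>. \<nu> \<in> P1 \<Longrightarrow> bid_ask_dist \<mu> \<nu> < r \<Longrightarrow> wasserstein1 \<mu> \<nu> < e"
proof -
  \<comment> \<open>The final bound is \<open>4 * h\<close> plus a term below \<open>h\<close>,
    hence less than \<open>5 * h < e\<close>.\<close>
  define h where "h = e / 8"
  have h: "h > 0" using \<open>e > 0\<close> by (simp add: h_def)
  obtain K where n: "call \<mu> K < h" and K: "K \<ge> 0"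
    using eventually_conj[OF order_tendstoD(2)[OF call_tendsto_0[OF \<mu>] h] eventually_ge_at_top[of 0]]
    by (auto simp: eventually_at_top_linorder)
  \<comment> \<open>This is the total coefficient of the distance in the final bound:
    \<open>4 / h * K\<close> from the middle part, 2 from the tail of \<nu>.\<close>
  define L where "L = 4 / h * K + 2"
  have L: "L > 0" using h K by (auto simp: L_def intro!: add_nonneg_pos)
  show thesis
  proof
    show "h / L > 0" using h L by simp
    fix \<nu> assume \<nu>: "\<nu> \<in> P1" and r: "bid_ask_dist \<mu> \<nu> < h / L"
    let ?d = "bid_ask_dist \<mu> \<nu>"
    have "call \<nu> K \<le> h + 2 * ?d"
      using abs_call_diff_le[OF \<mu> \<nu>, of "K"] n by linarith
    moreover have "wasserstein1 \<mu> \<nu> \<le> 2 * h + 2 * (2 * ?d) / h * K + (call \<mu> K + call \<nu> K)"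
      by (rule wasserstein1_le_of_call[OF \<mu> \<nu> h K abs_call_diff_le[OF \<mu> \<nu>]])
    ultimately have "wasserstein1 \<mu> \<nu> \<le> 4 * h + (4 / h * K * ?d + 2 * ?d)"
      using n by (simp add: ac_simps)
    also have "4 / h * K * ?d + 2 * ?d = ?d * L"
      by (simp add: L_def algebra_simps)
    also have "?d * L < h" using r L by (simp add: pos_less_divide_eq)
    finally show "wasserstein1 \<mu> \<nu> < e" using h by (simp add: h_def)
  qed
qed

lemma mtopology_bid_ask_eq_wasserstein1:
  "Metric_space.mtopology P1 bid_ask_dist = Metric_space.mtopology P1 wasserstein1"
proof -
  interpret d: Metric_space P1 bid_ask_dist by (rule Metric_space_bid_ask)
  interpret W: Metric_space P1 wasserstein1 by (rule Metric_space_wasserstein1)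
  have 1: "\<exists>r>0. d.mball \<mu> r \<subseteq> U" if U: "W.mball \<mu> e \<subseteq> U" and e: "e > 0" and \<mu>: "\<mu> \<in> P1" for U \<mu> e
  proof -
    obtain r where "r > 0" "\<And>\<nu>. \<nu> \<in> P1 \<Longrightarrow> bid_ask_dist \<mu> \<nu> < r \<Longrightarrow> wasserstein1 \<mu> \<nu> < e"
      using wasserstein1_small_of_bid_ask_small[OF \<mu> e] by blast
    then show ?thesis using U \<mu> by (intro exI[of _ r]) auto
  qed
  have 2: "W.mball \<mu> r \<subseteq> d.mball \<mu> r" for \<mu> r
    by (auto intro: le_less_trans[OF bid_ask_dist_le_wasserstein1])
  show ?thesis
    unfolding topology_eq d.openin_mtopology W.openin_mtopology
    using 1 2 by (meson subset_iff)
qed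

subsection \<open>Convex order\<close>

text \<open>A convex function may have slope \<open>-\<infinity>\<close> at 0, as \<open>- sqrt x\<close> does; translating it into the
  interior of the half-line removes this.\<close>

lemma convex_linear_growth_shift_lipschitz:
  assumes cv: "convex_on {0..} \<psi>" and lg: "linear_growth \<psi>" and h: "h > 0"
  obtains L where "L > 0" "L-lipschitz_on {0..} (\<lambda>x. \<psi> (x + h))"
proof -
  obtain C where C: "\<And>x. x \<ge> 0 \<Longrightarrow> \<bar>\<psi> x\<bar> \<le> C * (1 + x)"
    using lg by (auto simp: linear_growth_def)
  \<comment> \<open>The chord over \<open>[0, h]\<close> bounds from below every slope to the right
    of \<open>h\<close>; this is where the translation by \<open>h\<close> is needed.\<close>
  define m where "m = (\<psi> h - \<psi> 0) / h"
  define L where "L = max \<bar>m\<bar> \<bar>C\<bar> + 1"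
  have upper: "(\<psi> y - \<psi> x) / (y - x) \<le> C" if xy: "0 \<le> x" "x < y" for x y
  proof (rule ccontr)
    define s where "s = (\<psi> y - \<psi> x) / (y - x)"
    assume "\<not> (\<psi> y - \<psi> x) / (y - x) \<le> C"
    then have s: "s > C" by (simp add: s_def)
    \<comment> \<open>Beyond the quotient, the line through \<open>(x, \<psi> x)\<close> with slope
      \<open>s > C\<close> exceeds \<open>C * (1 + z)\<close>. By convexity \<psi> lies above this
      line from \<open>y\<close> on, which contradicts the growth bound.\<close>
    define z where "z = max y ((C + s * x - \<psi> x) / (s - C) + 1)"
    have z: "y \<le> z" "(C + s * x - \<psi> x) / (s - C) < z" by (auto simp: z_def)
    have "s \<le> (\<psi> z - \<psi> x) / (z - x)"
      unfolding s_def using xy z(1) by (intro convex_on_slope_mono[OF cv]) auto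
    then have "s * (z - x) \<le> \<psi> z - \<psi> x"
      using xy z(1) by (simp add: pos_le_divide_eq)
    moreover have "\<psi> z \<le> C * (1 + z)" using C[of z] xy z(1) by auto
    moreover have "C + s * x - \<psi> x < z * (s - C)"
      using z(2) s by (simp add: pos_divide_less_eq)
    ultimately show False by (simp add: algebra_simps)
  qed
  have "L-lipschitz_on {0..} (\<lambda>x. \<psi> (x + h))"
  proof (rule lipschitz_on_leI)
    fix x y :: real assume xy: "x \<in> {0..}" "y \<in> {0..}" "x \<le> y"
    show "dist (\<psi> (x + h)) (\<psi> (y + h)) \<le> L * dist x y"
    proof (cases "x = y")
      case False
      define s where "s = (\<psi> (y + h) - \<psi> (x + h)) / (y - x)"
      have "m \<le> s"
        using convex_on_slope_mono[OF cv, of 0 "y + h" "x + h" h] xy False h by (simp add: m_def s_def)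
      moreover have "s \<le> C"
        using upper[of "x + h" "y + h"] xy False h by (simp add: s_def)
      ultimately have "\<bar>s\<bar> \<le> L" by (auto simp: L_def)
      moreover have "\<bar>\<psi> (y + h) - \<psi> (x + h)\<bar> = \<bar>s\<bar> * (y - x)"
        using xy False by (simp add: s_def abs_divide)
      ultimately show ?thesis
        using xy by (simp add: dist_real_def abs_minus_commute mult_right_mono)
    qed simp
  qed (simp add: L_def)
  moreover have "L > 0" by (simp add: L_def add_nonneg_pos le_max_iff_disj)
  ultimately show thesis using that by blast
qed

text \<open>The shifts are at most 1, so \<open>C * (2 + x)\<close> dominates. Pointwise convergence
  rests on continuity up to the endpoint 0, where a convex function could jump.\<close>

lemma integral_shift_tendsto:
  assumes \<mu>: "\<mu> \<in> P1" and c: "continuous_on {0..} \<psi>" and lg: "linear_growth \<psi>"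
  shows "(\<lambda>n. \<integral>x. \<psi> (x + 1 / real (Suc n)) \<partial>\<mu>) \<longlonglongrightarrow> (\<integral>x. \<psi> x \<partial>\<mu>)"
proof -
  interpret prob_space \<mu> using P1D(1)[OF \<mu>] .
  obtain C where C: "\<And>x. x \<ge> 0 \<Longrightarrow> \<bar>\<psi> x\<bar> \<le> C * (1 + x)"
    using lg by (auto simp: linear_growth_def)
  have C0: "C \<ge> 0" using C[of 0] by simp
  show ?thesis
  proof (rule integral_dominated_convergence[where w="\<lambda>x. C * (2 + x)"])
    show "\<psi> \<in> borel_measurable \<mu>"
      by (rule measurable_P1_continuous[OF \<mu> c])
    show "(\<lambda>x. \<psi> (x + 1 / real (Suc n))) \<in> borel_measurable \<mu>" for n
      by (rule measurable_P1_continuous[OF \<mu>])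
        (auto intro!: continuous_intros continuous_on_compose2[OF c])
    show "integrable \<mu> (\<lambda>x. C * (2 + x))" using P1D(4)[OF \<mu>] by simp
    show "AE x in \<mu>. (\<lambda>n. \<psi> (x + 1 / real (Suc n))) \<longlonglongrightarrow> \<psi> x"
    proof (rule AE_I2)
      fix x assume "x \<in> space \<mu>"
      then have x: "x \<ge> 0" using P1D(3)[OF \<mu>] by simp
      have "(\<lambda>n. x + 1 / real (Suc n)) \<longlonglongrightarrow> x + 0"
        by (intro tendsto_intros) (rule lim_1_over_n[THEN LIMSEQ_Suc])
      then show "(\<lambda>n. \<psi> (x + 1 / real (Suc n))) \<longlonglongrightarrow> \<psi> x"
        using x by (intro continuous_on_tendsto_compose[OF c]) auto
    qed
    show "AE x in \<mu>. norm (\<psi> (x + 1 / real (Suc n))) \<le> C * (2 + x)" for n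
    proof (rule AE_I2)
      fix x assume "x \<in> space \<mu>"
      then have x: "x \<ge> 0" using P1D(3)[OF \<mu>] by simp
      have "\<bar>\<psi> (x + 1 / real (Suc n))\<bar> \<le> C * (1 + (x + 1 / real (Suc n)))"
        using x by (intro C) auto
      also have "\<dots> \<le> C * (2 + x)" using C0 by (intro mult_left_mono) auto
      finally show "norm (\<psi> (x + 1 / real (Suc n))) \<le> C * (2 + x)" by simp
    qed
  qed
qed

text \<open>Functions in \<open>convex_lip1\<close> are admissible in the convex order, which gives
  one direction. For the other, a test function is shifted by \<open>1 / (n + 1)\<close> and divided
  by its Lipschitz constant \<open>L\<close>. Because the directed distance is 0, the inequality
  survives multiplication by \<open>L\<close>, however large, and the shift is removed in the
  limit.\<close>

lemma convex_order_iff_directed_dist_0: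
  assumes \<mu>: "\<mu> \<in> P1" and \<nu>: "\<nu> \<in> P1"
  shows "directed_dist \<mu> \<nu> = 0 \<longleftrightarrow> \<mu> \<preceq>\<^sub>c\<^sub>x \<nu>"
proof
  assume "\<mu> \<preceq>\<^sub>c\<^sub>x \<nu>"
  then have "directed_dist \<mu> \<nu> \<le> 0"
    using convex_lip1_linear_growth(1,2)
    by (intro directed_dist_least[OF \<mu> \<nu>]) (auto simp: convex_order_def convex_lip1_def)
  then show "directed_dist \<mu> \<nu> = 0" using directed_dist_nonneg[of \<mu> \<nu>] by simp
next
  assume d0: "directed_dist \<mu> \<nu> = 0"
  show "\<mu> \<preceq>\<^sub>c\<^sub>x \<nu>"
    unfolding convex_order_def
  proof safe
    fix \<psi> assume c: "continuous_on {0..} \<psi>" and cv: "convex_on {0..} \<psi>" and lg: "linear_growth \<psi>"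
    have "(\<integral>x. \<psi> (x + 1 / real (Suc n)) \<partial>\<mu>) \<le> (\<integral>x. \<psi> (x + 1 / real (Suc n)) \<partial>\<nu>)" for n
    proof -
      define h where "h = 1 / real (Suc n)"
      have h: "h > 0" by (simp add: h_def)
      obtain L where L: "L > 0" "L-lipschitz_on {0..} (\<lambda>x. \<psi> (x + h))"
        using convex_linear_growth_shift_lipschitz[OF cv lg h] .
      have "convex_on {0..} (\<lambda>x. \<psi> (x + h))"
      proof (rule convex_onI)
        fix t x y :: real assume *: "0 < t" "t < 1" "x \<in> {0..}" "y \<in> {0..}"
        have "(1 - t) *\<^sub>R x + t *\<^sub>R y + h = (1 - t) *\<^sub>R (x + h) + t *\<^sub>R (y + h)"
          by (simp add: algebra_simps)
        then show "\<psi> ((1 - t) *\<^sub>R x + t *\<^sub>R y + h) \<le> (1 - t) * \<psi> (x + h) + t * \<psi> (y + h)"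
          using convex_onD[OF cv, of t "x + h" "y + h"] * h by simp
      qed simp
      then have "convex_on {0..} (\<lambda>x. \<psi> (x + h) / L)"
        using L(1) by (intro convex_on_cdiv) auto
      moreover have "1-lipschitz_on {0..} (\<lambda>x. \<psi> (x + h) / L)"
      proof (rule lipschitz_onI)
        fix x y :: real assume "x \<in> {0..}" "y \<in> {0..}"
        then have "\<bar>\<psi> (x + h) - \<psi> (y + h)\<bar> \<le> L * \<bar>x - y\<bar>"
          using lipschitz_onD[OF L(2)] by (simp add: dist_real_def)
        then show "dist (\<psi> (x + h) / L) (\<psi> (y + h) / L) \<le> 1 * dist x y"
          using L(1) by (simp add: dist_real_def abs_divide pos_divide_le_eq mult.commute flip: diff_divide_distrib)
      qed simp
      ultimately have "(\<lambda>x. \<psi> (x + h) / L) \<in> convex_lip1" by (simp add: convex_lip1_def)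
      from directed_dist_upper[OF \<mu> \<nu> this] show ?thesis
        using d0 L(1) by (simp add: h_def pos_divide_le_eq flip: diff_divide_distrib)
    qed
    then show "(\<integral>x. \<psi> x \<partial>\<mu>) \<le> (\<integral>x. \<psi> x \<partial>\<nu>)"
      by (intro LIMSEQ_le[OF integral_shift_tendsto[OF \<mu> c lg] integral_shift_tendsto[OF \<nu> c lg]]) auto
  qed
qed

subsection \<open>Interlacing grids\<close>

lemma sum_pairs_lessThan:
  fixes f :: "nat \<Rightarrow> 'a::comm_monoid_add"
  shows "(\<Sum>k<2 * n. f k) = (\<Sum>j<n. f (2 * j) + f (2 * j + 1))"
  by (induction n) (simp_all add: ac_simps)

text \<open>An image of the uniform law on \<open>2 * n + 2\<close> indices: repeated values of
  \<open>g\<close> become weights, and two such laws are coupled by sharing the index.\<close>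

definition grid_law :: "nat \<Rightarrow> (nat \<Rightarrow> nat) \<Rightarrow> real measure" where
  "grid_law n g = distr (measure_pmf (pmf_of_set {..<2 * Suc n})) (restrict_space borel {0..}) (\<lambda>k. real (g k))"

lemma grid_law_P1: "grid_law n g \<in> P1"
proof -
  have m: "(\<lambda>k. real (g k)) \<in> measurable (measure_pmf (pmf_of_set {..<2 * Suc n})) (restrict_space borel {0..})"
    by (auto simp: measurable_restrict_space2_iff)
  have "(\<lambda>x. x) \<in> borel_measurable (restrict_space borel {0::real..})"
    by (rule measurable_restrict_space1) simp
  then have "integrable (grid_law n g) (\<lambda>x. x)"
    unfolding grid_law_def by (subst integrable_distr_eq[OF m]) (auto intro!: integrable_measure_pmf_finite simp: set_pmf_of_set lessThan_empty_iff)
  moreover have "prob_space (grid_law n g)"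
    unfolding grid_law_def by (rule measure_pmf.prob_space_distr[OF m])
  ultimately show ?thesis
    by (simp add: P1_def) (simp add: grid_law_def)
qed

lemma integral_grid_law:
  assumes "continuous_on {0..} \<psi>"
  shows "(\<integral>x. \<psi> x \<partial>grid_law n g) = (\<Sum>k<2 * Suc n. \<psi> (real (g k))) / (2 * real (Suc n))"
proof -
  have m: "(\<lambda>k. real (g k)) \<in> measurable (measure_pmf (pmf_of_set {..<2 * Suc n})) (restrict_space borel {0..})"
    by (auto simp: measurable_restrict_space2_iff)
  have "(\<integral>x. \<psi> x \<partial>grid_law n g) = (\<integral>k. \<psi> (real (g k)) \<partial>measure_pmf (pmf_of_set {..<2 * Suc n}))"
    unfolding grid_law_def
    by (rule integral_distr[OF m borel_measurable_continuous_on_restrict[OF assms]])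
  also have "\<dots> = (\<Sum>k<2 * Suc n. \<psi> (real (g k))) / real (card {..<2 * Suc n})"
    by (rule integral_pmf_of_set) auto
  finally show ?thesis by simp
qed

lemma AE_grid_law_range: "AE x in grid_law n g. x \<in> range (\<lambda>k. real (g k))"
proof -
  have m: "(\<lambda>k. real (g k)) \<in> measurable (measure_pmf (pmf_of_set {..<2 * Suc n})) (restrict_space borel {0..})"
    by (auto simp: measurable_restrict_space2_iff)
  have "range (\<lambda>k. real (g k)) \<in> sets borel"
    by (rule sets.countable) auto
  then have "{x \<in> space (restrict_space borel {0..}). x \<in> range (\<lambda>k. real (g k))} \<in> sets (restrict_space borel {0..})"
    by (auto simp: sets_restrict_space space_restrict_space)
  then show ?thesis
    unfolding grid_law_def by (subst AE_distr_iff[OF m]) auto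
qed

text \<open>The even values run 0, 2, 2, 4, 4, ..., 2n, 2n, 2n+2, so the two endpoints have half
  weight; the odd values run 1, 1, 3, 3, ..., 2n+1, 2n+1. Values with the same index differ by
  1.\<close>

abbreviation "even_grid n \<equiv> grid_law n (\<lambda>k. 2 * ((k + 1) div 2))"
abbreviation "odd_grid n \<equiv> grid_law n (\<lambda>k. 2 * (k div 2) + 1)"

text \<open>Whatever the coupling, almost surely an even integer is matched with an odd one.\<close>

lemma even_odd_grid_coupling_cost:
  assumes \<pi>: "\<pi> \<in> couplings (even_grid n) (odd_grid n)"
  shows "1 \<le> (\<integral>z. \<bar>fst z - snd z\<bar> \<partial>\<pi>)"
proof -
  note m = couplingsD[OF \<pi>]
  interpret prob_space \<pi> by (rule prob_space_coupling[OF grid_law_P1 \<pi>])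
  have "AE z in \<pi>. fst z \<in> range (\<lambda>k. real (2 * ((k + 1) div 2)))"
    by (rule AE_distrD[OF m(1)]) (simp only: m(3) AE_grid_law_range)
  moreover have "AE z in \<pi>. snd z \<in> range (\<lambda>k. real (2 * (k div 2) + 1))"
    by (rule AE_distrD[OF m(2)]) (simp only: m(4) AE_grid_law_range)
  ultimately have "AE z in \<pi>. 1 \<le> \<bar>fst z - snd z\<bar>"
  proof eventually_elim
    case (elim z)
    then obtain a b :: nat where z: "fst z = real (2 * a)" "snd z = real (2 * b + 1)" by auto
    have "1 \<le> \<bar>int (2 * a) - int (2 * b + 1)\<bar>" by presburger
    then have "1 \<le> \<bar>real_of_int (int (2 * a) - int (2 * b + 1))\<bar>" by linarith
    then show ?case by (simp add: z)
  qed
  then have "(\<integral>z. 1 \<partial>\<pi>) \<le> (\<integral>z. \<bar>fst z - snd z\<bar> \<partial>\<pi>)"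
    by (intro integral_mono_AE coupling_cost_integrable[OF grid_law_P1 grid_law_P1 \<pi>]) auto
  then show ?thesis by (simp add: prob_space)
qed

text \<open>The coupling through the common index moves all mass by exactly 1 and so meets the
  parity bound.\<close>

lemma wasserstein1_even_odd_grid: "wasserstein1 (even_grid n) (odd_grid n) = 1"
proof -
  let ?U = "measure_pmf (pmf_of_set {..<2 * Suc n})"
  let ?X = "\<lambda>k. real (2 * ((k + 1) div 2))" and ?Y = "\<lambda>k. real (2 * (k div 2) + 1)"
  let ?R = "restrict_space borel {0::real..}"
  have s: "sets (grid_law n g) = sets ?R" for g
    by (simp add: grid_law_def)
  have X: "?X \<in> measurable ?U (even_grid n)" and Y: "?Y \<in> measurable ?U (odd_grid n)"
    by (simp_all add: P1D(3)[OF grid_law_P1])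
  note XY = measurable_Pair[OF X Y]
  define \<pi> where "\<pi> = distr ?U (even_grid n \<Otimes>\<^sub>M odd_grid n) (\<lambda>k. (?X k, ?Y k))"
  have "distr \<pi> (even_grid n) fst = distr ?U (even_grid n) ?X"
    unfolding \<pi>_def by (subst distr_distr[OF measurable_fst XY]) (simp add: comp_def)
  also have "\<dots> = even_grid n"
    unfolding grid_law_def by (rule distr_cong) (auto simp: s)
  finally have 1: "distr \<pi> (even_grid n) fst = even_grid n" .
  have "distr \<pi> (odd_grid n) snd = distr ?U (odd_grid n) ?Y"
    unfolding \<pi>_def by (subst distr_distr[OF measurable_snd XY]) (simp add: comp_def)
  also have "\<dots> = odd_grid n"
    unfolding grid_law_def by (rule distr_cong) (auto simp: s)
  finally have 2: "distr \<pi> (odd_grid n) snd = odd_grid n" .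
  have \<pi>: "\<pi> \<in> couplings (even_grid n) (odd_grid n)"
    using 1 2 by (simp add: couplings_def) (simp add: \<pi>_def)
  have "(\<integral>z. \<bar>fst z - snd z\<bar> \<partial>\<pi>) = (\<integral>k. \<bar>?X k - ?Y k\<bar> \<partial>?U)"
  proof -
    have "(\<lambda>z. \<bar>fst z - snd z\<bar>) \<in> borel_measurable (even_grid n \<Otimes>\<^sub>M odd_grid n)"
      using measurable_ident_P1[OF grid_law_P1] by measurable
    then show ?thesis
      unfolding \<pi>_def by (subst integral_distr[OF XY]) auto
  qed
  also have "\<dots> = (\<integral>k. 1 \<partial>?U)"
  proof (rule Bochner_Integration.integral_cong)
    fix k :: nat
    have "\<bar>int (2 * ((k + 1) div 2)) - int (2 * (k div 2) + 1)\<bar> = 1" by presburger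
    then have "\<bar>real_of_int (int (2 * ((k + 1) div 2)) - int (2 * (k div 2) + 1))\<bar> = 1" by linarith
    then show "\<bar>?X k - ?Y k\<bar> = 1" by simp
  qed simp
  finally have cost: "(\<integral>z. \<bar>fst z - snd z\<bar> \<partial>\<pi>) = 1" by simp
  have "(INF \<pi>\<in>couplings (even_grid n) (odd_grid n). \<integral>z. \<bar>fst z - snd z\<bar> \<partial>\<pi>) = 1"
    using \<pi> cost even_odd_grid_coupling_cost by (intro cInf_eq_minimum) (force, blast)
  then show ?thesis by (simp add: wasserstein1_def grid_law_P1)
qed

text \<open>The indices \<open>2 * j\<close> and \<open>2 * j + 1\<close> together contribute the
  second difference of \<psi> around \<open>2 * j + 1\<close>, which is an increment of the
  nondecreasing sequence \<open>D\<close> of unit-step slopes. The total is at most 2, as slopes lie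
  in \<open>[-1, 1]\<close>, and is divided by the number of indices.\<close>

lemma even_odd_grid_convex_gap:
  assumes \<psi>: "\<psi> \<in> convex_lip1"
  shows "0 \<le> (\<integral>x. \<psi> x \<partial>even_grid n) - (\<integral>x. \<psi> x \<partial>odd_grid n)"
    and "(\<integral>x. \<psi> x \<partial>even_grid n) - (\<integral>x. \<psi> x \<partial>odd_grid n) \<le> 1 / real (Suc n)"
proof -
  note c = convex_lip1_linear_growth(1)[OF \<psi>]
  have cv: "convex_on {0..} \<psi>" and lip: "1-lipschitz_on {0..} \<psi>"
    using \<psi> by (auto simp: convex_lip1_def)
  define D where "D i = \<psi> (real i + 1) - \<psi> (real i)" for i :: nat
  have D_mono: "D i \<le> D (Suc i)" for i
    using convex_on_slope_mono[OF cv, of "real i" "real i + 2" "real i + 1" "real i + 1"]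
    by (simp add: D_def add.commute add.left_commute)
  have D_bound: "\<bar>D i\<bar> \<le> 1" for i
    using lipschitz_onD[OF lip, of "real i + 1" "real i"] by (simp add: D_def dist_real_def)
  define T where "T = (\<Sum>j<Suc n. D (2 * j + 1) - D (2 * j))"
  have gap: "(\<integral>x. \<psi> x \<partial>even_grid n) - (\<integral>x. \<psi> x \<partial>odd_grid n) = T / (2 * real (Suc n))"
  proof -
    have "(\<Sum>k<2 * Suc n. \<psi> (real (2 * ((k + 1) div 2)))) - (\<Sum>k<2 * Suc n. \<psi> (real (2 * (k div 2) + 1))) = T"
      unfolding sum_pairs_lessThan T_def sum_subtractf[symmetric]
      by (intro sum.cong) (simp_all add: D_def add_ac)
    then show ?thesis
      by (simp only: integral_grid_law[OF c] diff_divide_distrib[symmetric])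
  qed
  \<comment> \<open>Only every other increment of \<open>D\<close> occurs in the sum; adding the
    skipped ones, which are nonnegative, makes it telescope.\<close>
  have "(\<Sum>j<m. D (2 * j + 1) - D (2 * j)) \<le> D (2 * m) - D 0" for m
  proof (induction m)
    case (Suc m)
    then show ?case using D_mono[of "2 * m + 1"] by simp
  qed simp
  from this[of "Suc n"] have "T \<le> 2"
    using D_bound[of "2 * Suc n"] D_bound[of 0] unfolding T_def by linarith
  then have "T / (2 * real (Suc n)) \<le> 2 / (2 * real (Suc n))"
    by (rule divide_right_mono) simp
  also have "\<dots> = 1 / real (Suc n)" using mult_divide_mult_cancel_left[of 2 1 "real (Suc n)"] by simp
  finally have "T / (2 * real (Suc n)) \<le> 1 / real (Suc n)" .
  then show "(\<integral>x. \<psi> x \<partial>even_grid n) - (\<integral>x. \<psi> x \<partial>odd_grid n) \<le> 1 / real (Suc n)"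
    by (simp only: gap)
  have "0 \<le> T"
    unfolding T_def using D_mono by (intro sum_nonneg) simp
  then show "0 \<le> (\<integral>x. \<psi> x \<partial>even_grid n) - (\<integral>x. \<psi> x \<partial>odd_grid n)"
    by (simp only: gap) simp
qed

lemma bid_ask_dist_even_odd_grid: "bid_ask_dist (even_grid n) (odd_grid n) \<le> 1 / real (Suc n)"
proof -
  have "directed_dist (even_grid n) (odd_grid n) \<le> 1 / real (Suc n)"
    by (rule directed_dist_least[OF grid_law_P1 grid_law_P1 even_odd_grid_convex_gap(2)])
  moreover have "directed_dist (odd_grid n) (even_grid n) \<le> 0"
    using even_odd_grid_convex_gap(1) by (intro directed_dist_least[OF grid_law_P1 grid_law_P1]) force
  moreover have "0 \<le> 1 / real (Suc n)" by simp
  ultimately show ?thesis unfolding bid_ask_dist_def by argo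
qed

lemma bid_ask_dist_even_odd_grid_tendsto: "(\<lambda>n. bid_ask_dist (even_grid n) (odd_grid n)) \<longlonglongrightarrow> 0"
proof (rule tendsto_sandwich[OF always_eventually always_eventually tendsto_const])
  show "(\<lambda>n. 1 / real (Suc n)) \<longlonglongrightarrow> 0"
    by (rule lim_1_over_n[THEN LIMSEQ_Suc])
  show "\<forall>n. 0 \<le> bid_ask_dist (even_grid n) (odd_grid n)"
    by (simp add: bid_ask_dist_def directed_dist_nonneg)
  show "\<forall>n. bid_ask_dist (even_grid n) (odd_grid n) \<le> 1 / real (Suc n)"
    by (intro allI bid_ask_dist_even_odd_grid)
qed

subsection \<open>Equal barycenters\<close>

text \<open>Each bracket is a ramp that rises from 0 to \<open>h\<close> on the \<open>k\<close>-th
  cell, so the sum is the piecewise linear interpolation of \<open>\<psi> - \<psi> 0\<close>,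
  constant after the last node. The induction needs exactness for \<open>x\<close> beyond that node.
  Inside a cell, \<psi> and the interpolation each move by at most \<open>h\<close> from the left
  node.\<close>

lemma interpolation_error:
  fixes \<psi> :: "real \<Rightarrow> real" and s :: "nat \<Rightarrow> real"
  assumes lip: "1-lipschitz_on {0..} \<psi>" and h: "h > 0"
    and s: "\<And>k. s k = (\<psi> (real (Suc k) * h) - \<psi> (real k * h)) / h" and x: "x \<ge> 0"
  shows "\<bar>(\<Sum>k<N. s k * (max (x - real k * h) 0 - max (x - real (Suc k) * h) 0))
      - (\<psi> (min x (real N * h)) - \<psi> 0)\<bar> \<le> (if real N * h \<le> x then 0 else 2 * h)"
proof (induction N)
  case (Suc N)
  let ?q = "\<lambda>N. \<Sum>k<N. s k * (max (x - real k * h) 0 - max (x - real (Suc k) * h) 0)"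
  have step: "real (Suc N) * h = real N * h + h" by (simp add: algebra_simps)
  have Nh: "0 \<le> real N * h" using h by simp
  have s1: "\<bar>s N\<bar> \<le> 1"
    using lipschitz_onD[OF lip, of "real (Suc N) * h" "real N * h"] h Nh step
    by (simp add: s dist_real_def abs_divide)
  consider "x < real N * h" | "real N * h \<le> x" "x < real (Suc N) * h" | "real (Suc N) * h \<le> x"
    by linarith
  then show ?case
  proof cases
    case 1
    then have "min x (real (Suc N) * h) = min x (real N * h)" "\<not> real (Suc N) * h \<le> x"
      using h step by auto
    moreover have "?q (Suc N) = ?q N" using 1 h step by simp
    ultimately show ?thesis using Suc.IH 1 by simp
  next
    case 2
    have q: "?q N = \<psi> (real N * h) - \<psi> 0" using Suc.IH 2 by (simp add: min_def)
    have "?q (Suc N) = ?q N + s N * (x - real N * h)" using 2 by simp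
    moreover have "\<bar>s N * (x - real N * h)\<bar> \<le> 1 * h"
      unfolding abs_mult using s1 2 step by (intro mult_mono) auto
    moreover have "\<bar>\<psi> x - \<psi> (real N * h)\<bar> \<le> h"
      using lipschitz_onD[OF lip, of x "real N * h"] 2 Nh x step by (simp add: dist_real_def)
    moreover have "min x (real (Suc N) * h) = x" "\<not> real (Suc N) * h \<le> x" using 2 by auto
    ultimately show ?thesis using q by simp
  next
    case 3
    then have "real N * h \<le> x" using h step by linarith
    then have q: "?q N = \<psi> (real N * h) - \<psi> 0" using Suc.IH by (simp add: min_def)
    have "?q (Suc N) = ?q N + s N * h" using 3 \<open>real N * h \<le> x\<close> step by simp
    also have "s N * h = \<psi> (real (Suc N) * h) - \<psi> (real N * h)" using h by (simp add: s)
    finally show ?thesis using q 3 by (simp add: min_def)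
  qed
qed (use x in simp)

text \<open>Summation by parts: the weights of the \<open>c k\<close> become the increments of
  \<open>s\<close>, which are nonnegative, so an upper bound on \<open>c\<close> suffices. The last
  boundary term is kept.\<close>

lemma abel_sum_bound:
  fixes s c :: "nat \<Rightarrow> real"
  assumes "incseq s" "c 0 = 0" "\<And>k. c k \<le> S"
  shows "(\<Sum>k<Suc N. s k * (c k - c (Suc k))) \<le> (s N - s 0) * S - s N * c (Suc N)"
proof (induction N)
  case (Suc N)
  have "(s (Suc N) - s N) * c (Suc N) \<le> (s (Suc N) - s N) * S"
    using assms incseq_SucD[OF assms(1)] by (intro mult_left_mono) auto
  with Suc show ?case by (simp add: algebra_simps)
qed (simp add: assms)

text \<open>A discrete form of the mixture of call payoffs: \<psi> is truncated at a grid point and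
  interpolated, and summation by parts turns the slopes into nonnegative weights of total mass at
  most 2. Equal means make the boundary term at strike 0 vanish; the one at the truncation point
  vanishes in the limit.\<close>

lemma directed_dist_le_call_sup:
  assumes \<mu>: "\<mu> \<in> P1" and \<nu>: "\<nu> \<in> P1" and mean: "(\<integral>x. x \<partial>\<mu>) = (\<integral>x. x \<partial>\<nu>)"
    and S: "\<And>K. K \<ge> 0 \<Longrightarrow> call \<mu> K - call \<nu> K \<le> S"
  shows "directed_dist \<mu> \<nu> \<le> 2 * S"
proof (rule directed_dist_least[OF \<mu> \<nu>])
  fix \<psi> assume \<psi>: "\<psi> \<in> convex_lip1"
  have cv: "convex_on {0..} \<psi>" and lip: "1-lipschitz_on {0..} \<psi>"
    using \<psi> by (auto simp: convex_lip1_def)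
  note cont = convex_lip1_linear_growth(1)[OF \<psi>]
  have call0: "call \<rho> 0 = (\<integral>x. x \<partial>\<rho>)" if "\<rho> \<in> P1" for \<rho>
    unfolding call_def using P1D(3)[OF that] by (intro Bochner_Integration.integral_cong) auto
  have S0: "0 \<le> S" using S[of 0] mean by (simp add: call0 \<mu> \<nu>)
  have trunc_meas: "(\<lambda>x. \<psi> (min x K)) \<in> borel_measurable \<rho>" if "\<rho> \<in> P1" "K \<ge> 0" for \<rho> K
    using that(2) by (intro measurable_P1_continuous[OF that(1)] continuous_on_compose2[OF cont] continuous_intros) auto
  have trunc_bound: "\<bar>\<psi> (min x K)\<bar> \<le> \<bar>\<psi> 0\<bar> + x" if "x \<ge> 0" "K \<ge> 0" for x K
    using convex_lip1_linear_growth(3)[OF \<psi>, of "min x K"] that by linarith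
  have bound_int: "integrable \<rho> (\<lambda>x. \<bar>\<psi> 0\<bar> + x)" if "\<rho> \<in> P1" for \<rho>
  proof -
    interpret prob_space \<rho> using P1D(1)[OF that] .
    show ?thesis using P1D(4)[OF that] by simp
  qed
  have trunc_int: "integrable \<rho> (\<lambda>x. \<psi> (min x K))" if "\<rho> \<in> P1" "K \<ge> 0" for \<rho> K
  proof (rule Bochner_Integration.integrable_bound[OF bound_int trunc_meas])
    show "AE x in \<rho>. norm (\<psi> (min x K)) \<le> norm (\<bar>\<psi> 0\<bar> + x)"
      using trunc_bound that P1D(3)[OF that(1)] by (intro AE_I2) force
  qed (use that in auto)
  have trunc_lim: "((\<lambda>K. \<integral>x. \<psi> (min x K) \<partial>\<rho>) \<longlongrightarrow> (\<integral>x. \<psi> x \<partial>\<rho>)) at_top" if \<rho>: "\<rho> \<in> P1" for \<rho>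
  proof -
    \<comment> \<open>With \<open>max K 0\<close> the function is evaluated only on the half-line
      for every \<open>K\<close>, as measurability of the whole family demands.\<close>
    have "((\<lambda>K. \<integral>x. \<psi> (min x (max K 0)) \<partial>\<rho>) \<longlongrightarrow> (\<integral>x. \<psi> x \<partial>\<rho>)) at_top"
    proof (rule integral_dominated_convergence_at_top[OF _ _ bound_int[OF \<rho>]])
      show "AE x in \<rho>. ((\<lambda>K. \<psi> (min x (max K 0))) \<longlongrightarrow> \<psi> x) at_top"
      proof (rule AE_I2)
        fix x assume "x \<in> space \<rho>"
        show "((\<lambda>K. \<psi> (min x (max K 0))) \<longlongrightarrow> \<psi> x) at_top"
          by (intro tendsto_eventually eventually_mono[OF eventually_ge_at_top[of x]]) (simp add: min_def max_def)
      qed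
      show "\<forall>\<^sub>F K in at_top. AE x in \<rho>. norm (\<psi> (min x (max K 0))) \<le> \<bar>\<psi> 0\<bar> + x"
        using trunc_bound P1D(3)[OF \<rho>] by (intro always_eventually allI AE_I2) simp
    qed (use trunc_meas \<rho> measurable_P1_continuous[OF \<rho> cont] in auto)
    moreover have "\<forall>\<^sub>F K in at_top. (\<integral>x. \<psi> (min x (max K 0)) \<partial>\<rho>) = (\<integral>x. \<psi> (min x K) \<partial>\<rho>)"
      by (rule eventually_mono[OF eventually_ge_at_top[of 0]]) (simp add: max_def)
    ultimately show ?thesis by (rule Lim_transform_eventually)
  qed
  \<comment> \<open>The \<open>4 * h\<close> consists of an interpolation error \<open>2 * h\<close>
    for each measure; the absolute value is the boundary term of the summation by parts.\<close>
  have key: "(\<integral>x. \<psi> (min x (real (Suc N) * h)) \<partial>\<mu>) - (\<integral>x. \<psi> (min x (real (Suc N) * h)) \<partial>\<nu>)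
      \<le> 4 * h + 2 * S + \<bar>call \<mu> (real (Suc N) * h) - call \<nu> (real (Suc N) * h)\<bar>" if h: "h > 0" for h N
  proof -
    define s where "s k = (\<psi> (real (Suc k) * h) - \<psi> (real k * h)) / h" for k
    define q where "q x = (\<Sum>k<Suc N. s k * (max (x - real k * h) 0 - max (x - real (Suc k) * h) 0))" for x
    define c where "c k = call \<mu> (real k * h) - call \<nu> (real k * h)" for k
    let ?K = "real (Suc N) * h"
    have K: "?K \<ge> 0" using h by simp
    have step: "real (Suc k) * h - real k * h = h" for k by (simp add: algebra_simps)
    have grid: "0 \<le> real k * h" for k using h by simp
    have inc: "incseq s"
    proof (rule incseq_SucI)
      fix k
      have "(\<psi> (real (Suc k) * h) - \<psi> (real k * h)) / (real (Suc k) * h - real k * h)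
        \<le> (\<psi> (real (Suc (Suc k)) * h) - \<psi> (real (Suc k) * h)) / (real (Suc (Suc k)) * h - real (Suc k) * h)"
        using h grid by (intro convex_on_slope_mono[OF cv]) auto
      then show "s k \<le> s (Suc k)" unfolding s_def step .
    qed
    have s1: "\<bar>s k\<bar> \<le> 1" for k
    proof -
      have "\<bar>\<psi> (real (Suc k) * h) - \<psi> (real k * h)\<bar> \<le> \<bar>real (Suc k) * h - real k * h\<bar>"
        using lipschitz_onD[OF lip, of "real (Suc k) * h" "real k * h"] grid[of k] grid[of "Suc k"]
        by (simp add: dist_real_def)
      then show ?thesis
        unfolding step using h by (simp add: s_def abs_divide)
    qed
    have qi: "integrable \<rho> q"
      and qe: "(\<integral>x. q x \<partial>\<rho>) = (\<Sum>k<Suc N. s k * (call \<rho> (real k * h) - call \<rho> (real (Suc k) * h)))"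
      if "\<rho> \<in> P1" for \<rho>
    proof -
      note i = integrable_call[OF that]
      have j: "integrable \<rho> (\<lambda>x. s k * (max (x - real k * h) 0 - max (x - real (Suc k) * h) 0))" for k
        by (intro integrable_mult_right Bochner_Integration.integrable_diff i)
      show "integrable \<rho> q"
        unfolding q_def by (intro Bochner_Integration.integrable_sum j)
      have "(\<integral>x. q x \<partial>\<rho>) = (\<Sum>k<Suc N. \<integral>x. s k * (max (x - real k * h) 0 - max (x - real (Suc k) * h) 0) \<partial>\<rho>)"
        unfolding q_def by (rule Bochner_Integration.integral_sum) (rule j)
      also have "\<dots> = (\<Sum>k<Suc N. s k * (call \<rho> (real k * h) - call \<rho> (real (Suc k) * h)))"
        unfolding call_def
        by (intro sum.cong refl) (simp only: integral_mult_right_zero Bochner_Integration.integral_diff[OF i i])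
      finally show "(\<integral>x. q x \<partial>\<rho>) = \<dots>" .
    qed
    have err: "\<bar>(\<integral>x. q x \<partial>\<rho>) - ((\<integral>x. \<psi> (min x ?K) \<partial>\<rho>) - \<psi> 0)\<bar> \<le> 2 * h" if \<rho>: "\<rho> \<in> P1" for \<rho>
    proof -
      interpret prob_space \<rho> using P1D(1)[OF \<rho>] .
      note i = qi[OF \<rho>] trunc_int[OF \<rho> K]
      have "(\<integral>x. q x \<partial>\<rho>) - ((\<integral>x. \<psi> (min x ?K) \<partial>\<rho>) - \<psi> 0) = (\<integral>x. q x - (\<psi> (min x ?K) - \<psi> 0) \<partial>\<rho>)"
        using i by (simp add: prob_space)
      also have "\<bar>\<dots>\<bar> \<le> (\<integral>x. \<bar>q x - (\<psi> (min x ?K) - \<psi> 0)\<bar> \<partial>\<rho>)"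
        by (rule integral_abs_bound)
      also have "\<dots> \<le> (\<integral>x. 2 * h \<partial>\<rho>)"
      proof (rule integral_mono)
        fix x assume "x \<in> space \<rho>"
        then have "x \<ge> 0" using P1D(3)[OF \<rho>] by simp
        from interpolation_error[OF lip h s_def this, of "Suc N"]
        show "\<bar>q x - (\<psi> (min x ?K) - \<psi> 0)\<bar> \<le> 2 * h"
          unfolding q_def by (rule order_trans) (use h in simp)
      qed (use i in auto)
      finally show ?thesis by (simp add: prob_space)
    qed
    have "(\<integral>x. q x \<partial>\<mu>) - (\<integral>x. q x \<partial>\<nu>) = (\<Sum>k<Suc N. s k * (c k - c (Suc k)))"
      unfolding qe[OF \<mu>] qe[OF \<nu>] sum_subtractf[symmetric] c_def
      by (intro sum.cong refl) (simp add: algebra_simps)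
    also have "\<dots> \<le> (s N - s 0) * S - s N * c (Suc N)"
      using h S by (intro abel_sum_bound inc) (auto simp: c_def call0 \<mu> \<nu> mean)
    also have "\<dots> \<le> 2 * S + \<bar>c (Suc N)\<bar>"
    proof -
      have "(s N - s 0) * S \<le> 2 * S"
        using s1[of N] s1[of 0] S0 by (intro mult_right_mono) auto
      moreover have "\<bar>s N * c (Suc N)\<bar> \<le> \<bar>c (Suc N)\<bar>"
        using mult_right_mono[OF s1[of N], of "\<bar>c (Suc N)\<bar>"] by (simp add: abs_mult)
      ultimately show ?thesis by linarith
    qed
    finally have "(\<integral>x. q x \<partial>\<mu>) - (\<integral>x. q x \<partial>\<nu>) \<le> 2 * S + \<bar>c (Suc N)\<bar>" .
    with err[OF \<mu>] err[OF \<nu>] show ?thesis unfolding c_def by linarith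
  qed
  have "(\<integral>x. \<psi> x \<partial>\<mu>) - (\<integral>x. \<psi> x \<partial>\<nu>) \<le> 2 * S + e" if "e > 0" for e
  proof -
    define h where "h = e / 4"
    have h: "h > 0" using that by (simp add: h_def)
    have lim: "filterlim (\<lambda>N. real (Suc N) * h) at_top sequentially"
      using h filterlim_compose[OF filterlim_real_sequentially filterlim_Suc]
      by (intro filterlim_at_top_mult_tendsto_pos[OF tendsto_const h])
    have "(\<lambda>N. 4 * h + 2 * S + \<bar>call \<mu> (real (Suc N) * h) - call \<nu> (real (Suc N) * h)\<bar>)
        \<longlonglongrightarrow> 4 * h + 2 * S + \<bar>0 - 0\<bar>"
      by (intro tendsto_intros filterlim_compose[OF call_tendsto_0 lim] \<mu> \<nu>)
    moreover have "(\<lambda>N. (\<integral>x. \<psi> (min x (real (Suc N) * h)) \<partial>\<mu>) - (\<integral>x. \<psi> (min x (real (Suc N) * h)) \<partial>\<nu>))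
        \<longlonglongrightarrow> (\<integral>x. \<psi> x \<partial>\<mu>) - (\<integral>x. \<psi> x \<partial>\<nu>)"
      by (intro tendsto_diff filterlim_compose[OF trunc_lim lim] \<mu> \<nu>)
    ultimately have "(\<integral>x. \<psi> x \<partial>\<mu>) - (\<integral>x. \<psi> x \<partial>\<nu>) \<le> 4 * h + 2 * S + \<bar>0 - 0\<bar>"
      using key[OF h] by (intro LIMSEQ_le) auto
    then show ?thesis by (simp add: h_def)
  qed
  then show "(\<integral>x. \<psi> x \<partial>\<mu>) - (\<integral>x. \<psi> x \<partial>\<nu>) \<le> 2 * S"
    by (rule field_le_epsilon)
qed

text \<open>For the lower bound, equal means cancel the linear part of the straddle payoff, and
  twice the call difference remains.\<close>

lemma directed_dist_eq_call_sup:
  assumes \<mu>: "\<mu> \<in> P1" and \<nu>: "\<nu> \<in> P1" and mean: "(\<integral>x. x \<partial>\<mu>) = (\<integral>x. x \<partial>\<nu>)"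
  shows "directed_dist \<mu> \<nu> = 2 * (SUP K\<in>{0..}. call \<mu> K - call \<nu> K)"
proof (rule antisym)
  have bdd: "bdd_above ((\<lambda>K. call \<mu> K - call \<nu> K) ` {0..})"
    using call_bdd_above[OF \<mu> \<nu>] by (simp add: call_def)
  show "directed_dist \<mu> \<nu> \<le> 2 * (SUP K\<in>{0..}. call \<mu> K - call \<nu> K)"
    by (rule directed_dist_le_call_sup[OF \<mu> \<nu> mean]) (rule cSUP_upper[OF _ bdd], simp)
  have "(SUP K\<in>{0..}. call \<mu> K - call \<nu> K) \<le> directed_dist \<mu> \<nu> / 2"
  proof (rule cSUP_least)
    fix K :: real
    have "(\<integral>x. 2 * max (x - K) 0 - x \<partial>\<rho>) = 2 * call \<rho> K - (\<integral>x. x \<partial>\<rho>)" if "\<rho> \<in> P1" for \<rho>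
      using integrable_call[OF that] P1D(4)[OF that] by (simp add: call_def)
    then show "call \<mu> K - call \<nu> K \<le> directed_dist \<mu> \<nu> / 2"
      using directed_dist_upper[OF \<mu> \<nu> straddle_in_convex_lip1, of K] mean \<mu> \<nu> by simp
  qed simp
  then show "2 * (SUP K\<in>{0..}. call \<mu> K - call \<nu> K) \<le> directed_dist \<mu> \<nu>" by simp
qed

theorem proposition4p3:
  shows
    "(\<forall>\<mu>\<in>P1. \<forall>\<nu>\<in>P1. directed_dist \<mu> \<nu> = 0 \<longleftrightarrow> \<mu> \<preceq>\<^sub>c\<^sub>x \<nu>)
   \<and> ((\<forall>\<mu>\<in>P1. \<forall>\<nu>\<in>P1. 0 \<le> directed_dist \<mu> \<nu>)
      \<and> (\<forall>\<mu>\<in>P1. \<forall>\<nu>\<in>P1. \<forall>\<rho>\<in>P1. directed_dist \<mu> \<rho> \<le> directed_dist \<mu> \<nu> + directed_dist \<nu> \<rho>)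
      \<and> (\<forall>\<mu>\<in>P1. \<forall>\<nu>\<in>P1. directed_dist \<mu> \<nu> = 0 \<and> directed_dist \<nu> \<mu> = 0 \<longrightarrow> \<mu> = \<nu>)
      \<and> Metric_space P1 bid_ask_dist)
   \<and> (\<forall>\<mu>\<in>P1. \<forall>\<nu>\<in>P1. (\<integral>x. x \<partial>\<mu>) = (\<integral>x. x \<partial>\<nu>) \<longrightarrow>
        directed_dist \<mu> \<nu> =
          2 * (SUP K\<in>{0..}. (\<integral>x. max (x - K) 0 \<partial>\<mu>) - (\<integral>x. max (x - K) 0 \<partial>\<nu>)))
   \<and> ((\<forall>\<mu>\<in>P1. \<forall>\<nu>\<in>P1. bid_ask_dist \<mu> \<nu> \<le> wasserstein1 \<mu> \<nu>)
      \<and> (\<exists>M N :: nat \<Rightarrow> real measure.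
            (\<forall>n. M n \<in> P1) \<and> (\<forall>n. N n \<in> P1)
          \<and> (\<lambda>n. bid_ask_dist (M n) (N n)) \<longlonglongrightarrow> 0
          \<and> (\<forall>n. wasserstein1 (M n) (N n) = 1)))
   \<and> (Metric_space P1 wasserstein1
      \<and> Metric_space.mtopology P1 bid_ask_dist = Metric_space.mtopology P1 wasserstein1)"
proof (intro conjI)
  show "\<forall>\<mu>\<in>P1. \<forall>\<nu>\<in>P1. directed_dist \<mu> \<nu> = 0 \<and> directed_dist \<nu> \<mu> = 0 \<longrightarrow> \<mu> = \<nu>"
    using bid_ask_dist_eq_0_imp_eq by (auto simp: bid_ask_dist_def)
  show "\<exists>M N :: nat \<Rightarrow> real measure.
            (\<forall>n. M n \<in> P1) \<and> (\<forall>n. N n \<in> P1)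
          \<and> (\<lambda>n. bid_ask_dist (M n) (N n)) \<longlonglongrightarrow> 0
          \<and> (\<forall>n. wasserstein1 (M n) (N n) = 1)"
    by (intro exI[of _ even_grid] exI[of _ odd_grid] conjI allI grid_law_P1
        bid_ask_dist_even_odd_grid_tendsto wasserstein1_even_odd_grid)
  show "\<forall>\<mu>\<in>P1. \<forall>\<nu>\<in>P1. (\<integral>x. x \<partial>\<mu>) = (\<integral>x. x \<partial>\<nu>) \<longrightarrow>
        directed_dist \<mu> \<nu> =
          2 * (SUP K\<in>{0..}. (\<integral>x. max (x - K) 0 \<partial>\<mu>) - (\<integral>x. max (x - K) 0 \<partial>\<nu>))"
    by (intro ballI impI directed_dist_eq_call_sup[unfolded call_def])
qed (intro ballI convex_order_iff_directed_dist_0 directed_dist_nonneg directed_dist_triangle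
       Metric_space_bid_ask bid_ask_dist_le_wasserstein1
       Metric_space_wasserstein1 mtopology_bid_ask_eq_wasserstein1; assumption)+

end
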